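(* Let $\mathbf{k}$ be a field. The structure of 2-term $EL_\infty$-algebra is homotopy-invariant: if $C$ is a 2-term $EL_\infty$-algebra, $C'$ is a 2-term cochain complex and $f:C\to C'$ is a quasi-isomorphism of complexes, then there exist a 2-term $EL_\infty$-algebra structure on $C'$, unique up to equivalence of $EL_\infty$-algebras, and a map $f^2$ such that $(f,f^2):C\to C'$ is a morphism of 2-term $EL_\infty$-algebras which is an equivalence in the 2-category of 2-term $EL_\infty$-algebras. Equivalently, the structure of a Lie 2-algebra is categorically invariant: if $L$ is a Lie 2-algebra, $L'$ a linear category and $F:L\to L'$ a fully faithful and essentially surjective linear functor, then there exist a Lie 2-algebra structure on $L'$, unique up to equivalence, and $F^2$ such that $(F,F^2):L\to L'$ is a morphism of Lie 2-algebras which is an equivalence in the 2-category of Lie 2-algebras. In particular, every Lie 2-algebra is equivalent, as a Lie 2-algebra, to a skeletal one.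
   Context: A 1-morphism in a 2-category is an equivalence if it has an inverse up to invertible 2-morphisms; two objects are equivalent if there is an equivalence between them. **Linear categories.** A linear category $V$ is a category internal to $\mathbf{k}$-vector spaces: objects $V_0$ and arrows $V_1$ are vector spaces and source $s$, target $t$, identity $x\mapsto 1_x$ and composition are linear. Linear functors and natural transformations are those whose structure maps are linear. The tensor product is $(V\otimes W)_i=V_i\otimes W_i$. Objects appearing in arrow expressions denote their identity arrows. A category is skeletal if isomorphic objects are equal; a Lie 2-algebra is skeletal if its underlying linear category is. (Equivalently, its normalized complex $N(V)$, given by $N(V)^0=V_0$, $N(V)^{-1}=\ker s$, $d=t|_{\ker s}$, has $d=0$.) **Lie 2-algebras.** A Lie 2-algebra is a linear category $L$ with a bilinear functor $[\cdot,\cdot]:L\otimes L\to L$, a bilinear natural transformation $S_{x,y}:[x,y]\to-[y,x]$ and a trilinear natural transformation $J_{x,y,z}:[x,[y,z]]\to[[x,y],z]+[y,[x,z]]$, such that for all objects $x,y,z,w$, with $\hat J_{x,y,z}=J_{x,y,z}^{-1}-1_{[y,[x,z]]}$: (L1) $([J_{x,y,z},w]+1_{[[y,z],[x,w]]}+1_{[[x,z],[y,w]]}+[z,J_{x,y,w}])\circ(J_{x,[y,z],w}+J_{x,z,[y,w]})\circ[x,J_{y,z,w}]=(1_{[[[x,y],z],w]}+1_{[z,[[x,y],w]]}+J_{y,[x,z],w}+J_{y,z,[x,w]})\circ(J_{[x,y],z,w}+[y,J_{x,z,w}])\circ J_{x,y,[z,w]}$; (L2) $(-\hat J_{y,x,z})\circ[S_{x,y},z]=\hat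 J_{x,y,z}$; (L3) $(-J_{x,z,y})\circ[x,S_{y,z}]=(S_{[x,y],z}+S_{y,[x,z]})\circ J_{x,y,z}$; (L4) $(-S_{[y,z],x})\circ S_{x,[y,z]}=1_{[x,[y,z]]}$. A morphism $(F,F^2):L\to L'$ is a linear functor $F$ with a linear natural transformation $F^2_{x,y}:[F(x),F(y)]'\to F([x,y])$ such that $F(S_{x,y})\circ F^2_{x,y}=(-F^2_{y,x})\circ S'_{F(x),F(y)}$ and $F(J_{x,y,z})\circ F^2_{x,[y,z]}\circ[F(x),F^2_{y,z}]'=(F^2_{[x,y],z}+F^2_{y,[x,z]})\circ([F^2_{x,y},F(z)]'+[F(y),F^2_{x,z}]')\circ J'_{F(x),F(y),F(z)}$. The composite of $(F,F^2)$ and $(G,G^2)$ is $(GF,(GF)^2)$ with $(GF)^2_{x,y}=G(F^2_{x,y})\circ G^2_{F(x),F(y)}$. A 2-morphism $\Theta:(F,F^2)\Rightarrow(G,G^2)$ is a linear natural transformation $\Theta:F\Rightarrow G$ with $\Theta_{[x,y]}\circ F^2_{x,y}=G^2_{x,y}\circ[\Theta_x,\Theta_y]'$, composed as natural transformations. **2-term $EL_\infty$-algebras.** A 2-term $EL_\infty$-algebra is a 2-term complex $C=(C^{-1}\xrightarrow{d}C^0)$ with bilinear brackets $[\cdot,\cdot]$ on $C^0\times C^0\to C^0$, $C^0\times C^{-1}\to C^{-1}$, $C^{-1}\times C^0\to C^{-1}$ satisfying $d[x,b]=[x,db]$, $d[a,y]=[da,y]$, $[da,b]=[a,db]$ (for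 $a,b\in C^{-1}$ one sets $[a,b]:=[da,b]=[a,db]$); a bilinear $\langle\cdot,\cdot\rangle:C^0\otimes C^0\to C^{-1}$ with $[x,y]+[y,x]=d\langle x,y\rangle$, $[a,y]+[y,a]=\langle da,y\rangle$, $[x,b]+[b,x]=\langle x,db\rangle$; and a trilinear $\langle\cdot,\cdot,\cdot\rangle:(C^0)^{\otimes3}\to C^{-1}$ such that $[u,[v,w]]-[[u,v],w]-[v,[u,w]]$ equals $d\langle u,v,w\rangle$ for $u,v,w\in C^0$, and $\langle du,v,w\rangle$, $\langle u,dv,w\rangle$, $\langle u,v,dw\rangle$ if exactly $u$, $v$, $w$ respectively lies in $C^{-1}$; subject to, for $x,y,z,w\in C^0$, $[x,\langle y,z,w\rangle]+\langle x,[y,z],w\rangle+\langle x,z,[y,w]\rangle+[\langle x,y,z\rangle,w]+[z,\langle x,y,w\rangle]=\langle x,y,[z,w]\rangle+\langle[x,y],z,w\rangle+[y,\langle x,z,w\rangle]+\langle y,[x,z],w\rangle+\langle y,z,[x,w]\rangle$; $\langle x,y,z\rangle+\langle y,x,z\rangle=-[\langle x,y\rangle,z]$; $\langle x,y,z\rangle+\langle x,z,y\rangle=[x,\langle y,z\rangle]-\langle[x,y],z\rangle-\langle y,[x,z]\rangle$; $\langle x,[y,z]\rangle=\langle[y,z],x\rangle$. A morphism $(f,f^2):C\to C'$ is a chain map $f=(f^0,f^1)$ ($f^0$ in degree $0$, $f^1$ in degree $-1$) with a bilinear $f^2:C^0\otimes C^0\to C'^{-1}$ satisfying $[f^0(x),f^0(y)]'-f^0([x,y])=d'f^2(x,y)$,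 $[f^1(a),f^0(y)]'-f^1([a,y])=f^2(da,y)$, $[f^0(x),f^1(b)]'-f^1([x,b])=f^2(x,db)$, and $\langle f^0(x),f^0(y)\rangle'-f^1(\langle x,y\rangle)=f^2(x,y)+f^2(y,x)$, $\langle f^0(x),f^0(y),f^0(z)\rangle'-f^1(\langle x,y,z\rangle)=[f^0(x),f^2(y,z)]'-[f^0(y),f^2(x,z)]'-[f^2(x,y),f^0(z)]'-f^2([x,y],z)-f^2(y,[x,z])+f^2(x,[y,z])$. The composite of $(f,f^2)$ and $(g,g^2)$ is $(gf,(g*f)^2)$ with $(g*f)^2(x,y)=g^2(f^0(x),f^0(y))+g^1(f^2(x,y))$. A 2-morphism $\theta:(f,f^2)\Rightarrow(g,g^2)$ is a linear $\theta:C^0\to C'^{-1}$ with $f^0-g^0=d'\theta$, $f^1-g^1=\theta d$ and $f^2(x,y)-g^2(x,y)=[f^0(x),\theta(y)]'+[\theta(x),f^0(y)]'-\theta([x,y])-[\theta(x),\theta(y)]'$; 2-morphisms compose as chain homotopies. **Correspondence.** Writing an arrow of $L$ with source $x$ as $(x,a)$, $a\in\ker s$, a Lie 2-algebra structure on $L$ corresponds to an $EL_\infty$-structure on $N(L)$ via restriction of the bracket and $S_{x,y}=([x,y],-\langle x,y\rangle)$, $J_{x,y,z}=([x,[y,z]],-\langle x,y,z\rangle)$; this gives an equivalence of 2-categories, under which fully faithful and essentially surjective linear functors correspond to quasi-isomorphisms. *)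

theory Defs
  imports Complex_Main
begin

section \<open>Vector spaces and multilinear maps\<close>

text \<open>
  A vector space is given by a scalar multiplication on an additive abelian group type together
  with a carrier, a subspace of that type; taking the carrier to be \<^term>\<open>UNIV\<close> gives an
  arbitrary vector space in the sense of the locale \<^locale>\<open>vector_space\<close>.  Carriers are needed
  because skeletal models of a Lie 2-algebra live on smaller spaces, and HOL cannot quantify
  existentially over types.  Maps are total functions of which only the values on carriers matter.
\<close>

record ('k, 'v) vspace =
  smul :: "'k \<Rightarrow> 'v \<Rightarrow> 'v"
  carr :: "'v set"

definition is_vspace :: "('k::field, 'v::ab_group_add) vspace \<Rightarrow> bool" where
  "is_vspace V \<longleftrightarrow> vector_space (smul V) \<and> module.subspace (smul V) (carr V)"

definition linear_map ::
  "('k, 'v::ab_group_add) vspace \<Rightarrow> ('k, 'w::ab_group_add) vspace \<Rightarrow> ('v \<Rightarrow> 'w) \<Rightarrow> bool" where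
  "linear_map V W f \<longleftrightarrow>
     (\<forall>x\<in>carr V. f x \<in> carr W) \<and>
     (\<forall>x\<in>carr V. \<forall>y\<in>carr V. f (x + y) = f x + f y) \<and>
     (\<forall>c. \<forall>x\<in>carr V. f (smul V c x) = smul W c (f x))"

definition bilinear_map ::
  "('k, 'u::ab_group_add) vspace \<Rightarrow> ('k, 'v::ab_group_add) vspace \<Rightarrow>
   ('k, 'w::ab_group_add) vspace \<Rightarrow> ('u \<Rightarrow> 'v \<Rightarrow> 'w) \<Rightarrow> bool" where
  "bilinear_map U V W f \<longleftrightarrow>
     (\<forall>x\<in>carr U. linear_map V W (\<lambda>y. f x y)) \<and>
     (\<forall>y\<in>carr V. linear_map U W (\<lambda>x. f x y))"

definition trilinear_map ::
  "('k, 't::ab_group_add) vspace \<Rightarrow> ('k, 'u::ab_group_add) vspace \<Rightarrow>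
   ('k, 'v::ab_group_add) vspace \<Rightarrow> ('k, 'w::ab_group_add) vspace \<Rightarrow>
   ('t \<Rightarrow> 'u \<Rightarrow> 'v \<Rightarrow> 'w) \<Rightarrow> bool" where
  "trilinear_map T U V W f \<longleftrightarrow>
     (\<forall>x\<in>carr T. \<forall>y\<in>carr U. linear_map V W (\<lambda>z. f x y z)) \<and>
     (\<forall>x\<in>carr T. \<forall>z\<in>carr V. linear_map U W (\<lambda>y. f x y z)) \<and>
     (\<forall>y\<in>carr U. \<forall>z\<in>carr V. linear_map T W (\<lambda>x. f x y z))"


section \<open>Linear categories\<close>

record ('k, 'o, 'a) lincat =
  Ob :: "('k, 'o) vspace"
  Ar :: "('k, 'a) vspace"
  src :: "'a \<Rightarrow> 'o"
  tgt :: "'a \<Rightarrow> 'o"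
  idt :: "'o \<Rightarrow> 'a"
  cmp :: "'a \<Rightarrow> 'a \<Rightarrow> 'a"  \<comment> \<open>\<^term>\<open>cmp L g f\<close> is the composite ``g after f''\<close>

definition arrow_in :: "('k, 'o, 'a) lincat \<Rightarrow> 'a \<Rightarrow> 'o \<Rightarrow> 'o \<Rightarrow> bool" where
  "arrow_in L f x y \<longleftrightarrow> f \<in> carr (Ar L) \<and> src L f = x \<and> tgt L f = y"

definition composable :: "('k, 'o, 'a) lincat \<Rightarrow> 'a \<Rightarrow> 'a \<Rightarrow> bool" where
  "composable L g f \<longleftrightarrow> g \<in> carr (Ar L) \<and> f \<in> carr (Ar L) \<and> src L g = tgt L f"

text \<open>
  Composition is a linear map on the fibre product of arrows over objects: this is
  \<open>cmp_add\<close> and \<open>cmp_smul\<close>.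
\<close>

locale linear_category =
  fixes L :: "('k::field, 'o::ab_group_add, 'a::ab_group_add) lincat"
  assumes Ob_vspace: "is_vspace (Ob L)"
    and Ar_vspace: "is_vspace (Ar L)"
    and src_linear: "linear_map (Ar L) (Ob L) (src L)"
    and tgt_linear: "linear_map (Ar L) (Ob L) (tgt L)"
    and idt_linear: "linear_map (Ob L) (Ar L) (idt L)"
    and src_idt: "x \<in> carr (Ob L) \<Longrightarrow> src L (idt L x) = x"
    and tgt_idt: "x \<in> carr (Ob L) \<Longrightarrow> tgt L (idt L x) = x"
    and cmp_arrow: "composable L g f \<Longrightarrow> arrow_in L (cmp L g f) (src L f) (tgt L g)"
    and cmp_add: "composable L g f \<Longrightarrow> composable L g' f' \<Longrightarrow>
      cmp L (g + g') (f + f') = cmp L g f + cmp L g' f'"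
    and cmp_smul: "composable L g f \<Longrightarrow>
      cmp L (smul (Ar L) c g) (smul (Ar L) c f) = smul (Ar L) c (cmp L g f)"
    and cmp_idt_right: "f \<in> carr (Ar L) \<Longrightarrow> cmp L f (idt L (src L f)) = f"
    and cmp_idt_left: "f \<in> carr (Ar L) \<Longrightarrow> cmp L (idt L (tgt L f)) f = f"
    and cmp_assoc: "composable L h g \<Longrightarrow> composable L g f \<Longrightarrow>
      cmp L h (cmp L g f) = cmp L (cmp L h g) f"

definition inverse_arrows :: "('k, 'o, 'a) lincat \<Rightarrow> 'a \<Rightarrow> 'a \<Rightarrow> bool" where
  "inverse_arrows L f g \<longleftrightarrow> composable L g f \<and> composable L f g \<and>
     cmp L g f = idt L (src L f) \<and> cmp L f g = idt L (tgt L f)"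

definition inv_arrow :: "('k, 'o, 'a) lincat \<Rightarrow> 'a \<Rightarrow> 'a" where
  "inv_arrow L f = (THE g. inverse_arrows L f g)"

definition isomorphic_objects :: "('k, 'o, 'a) lincat \<Rightarrow> 'o \<Rightarrow> 'o \<Rightarrow> bool" where
  "isomorphic_objects L x y \<longleftrightarrow> (\<exists>f g. arrow_in L f x y \<and> inverse_arrows L f g)"

definition skeletal :: "('k, 'o, 'a) lincat \<Rightarrow> bool" where
  "skeletal L \<longleftrightarrow>
     (\<forall>x\<in>carr (Ob L). \<forall>y\<in>carr (Ob L). isomorphic_objects L x y \<longrightarrow> x = y)"


subsection \<open>Linear functors\<close>

record ('o, 'a, 'p, 'b) ftor =
  fob :: "'o \<Rightarrow> 'p"
  far :: "'a \<Rightarrow> 'b"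

definition linear_functor ::
  "('k::field, 'o::ab_group_add, 'a::ab_group_add) lincat \<Rightarrow>
   ('k, 'p::ab_group_add, 'b::ab_group_add) lincat \<Rightarrow> ('o, 'a, 'p, 'b) ftor \<Rightarrow> bool" where
  "linear_functor L L' F \<longleftrightarrow>
     linear_map (Ob L) (Ob L') (fob F) \<and>
     linear_map (Ar L) (Ar L') (far F) \<and>
     (\<forall>f\<in>carr (Ar L). src L' (far F f) = fob F (src L f) \<and> tgt L' (far F f) = fob F (tgt L f)) \<and>
     (\<forall>x\<in>carr (Ob L). far F (idt L x) = idt L' (fob F x)) \<and>
     (\<forall>g f. composable L g f \<longrightarrow> far F (cmp L g f) = cmp L' (far F g) (far F f))"

definition fully_faithful ::
  "('k, 'o, 'a) lincat \<Rightarrow> ('k, 'p, 'b) lincat \<Rightarrow> ('o, 'a, 'p, 'b) ftor \<Rightarrow> bool" where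
  "fully_faithful L L' F \<longleftrightarrow>
     (\<forall>x\<in>carr (Ob L). \<forall>y\<in>carr (Ob L).
        bij_betw (far F) {f. arrow_in L f x y} {g. arrow_in L' g (fob F x) (fob F y)})"

definition essentially_surjective ::
  "('k, 'o, 'a) lincat \<Rightarrow> ('k, 'p, 'b) lincat \<Rightarrow> ('o, 'a, 'p, 'b) ftor \<Rightarrow> bool" where
  "essentially_surjective L L' F \<longleftrightarrow>
     (\<forall>y\<in>carr (Ob L'). \<exists>x\<in>carr (Ob L). isomorphic_objects L' (fob F x) y)"

definition id_ftor :: "('o, 'a, 'o, 'a) ftor" where
  "id_ftor = \<lparr>fob = (\<lambda>x. x), far = (\<lambda>f. f)\<rparr>"

definition comp_ftor ::
  "('p, 'b, 'q, 'c) ftor \<Rightarrow> ('o, 'a, 'p, 'b) ftor \<Rightarrow> ('o, 'a, 'q, 'c) ftor" where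
  "comp_ftor G F = \<lparr>fob = fob G \<circ> fob F, far = far G \<circ> far F\<rparr>"

definition linear_nat_trans ::
  "('k, 'o::ab_group_add, 'a) lincat \<Rightarrow> ('k, 'p, 'b::ab_group_add) lincat \<Rightarrow>
   ('o, 'a, 'p, 'b) ftor \<Rightarrow> ('o, 'a, 'p, 'b) ftor \<Rightarrow> ('o \<Rightarrow> 'b) \<Rightarrow> bool" where
  "linear_nat_trans L L' F G \<Theta> \<longleftrightarrow>
     linear_map (Ob L) (Ar L') \<Theta> \<and>
     (\<forall>x\<in>carr (Ob L). arrow_in L' (\<Theta> x) (fob F x) (fob G x)) \<and>
     (\<forall>f\<in>carr (Ar L). cmp L' (\<Theta> (tgt L f)) (far F f) = cmp L' (far G f) (\<Theta> (src L f)))"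


section \<open>Lie 2-algebras\<close>

record ('o, 'a) lie2_struct =
  lbo :: "'o \<Rightarrow> 'o \<Rightarrow> 'o"  \<comment> \<open>bracket on objects\<close>
  lba :: "'a \<Rightarrow> 'a \<Rightarrow> 'a"  \<comment> \<open>bracket on arrows\<close>
  altr :: "'o \<Rightarrow> 'o \<Rightarrow> 'a"  \<comment> \<open>the alternator \<open>S\<close>\<close>
  jctr :: "'o \<Rightarrow> 'o \<Rightarrow> 'o \<Rightarrow> 'a"  \<comment> \<open>the Jacobiator \<open>J\<close>\<close>

definition jctr_hat ::
  "('k, 'o, 'a::ab_group_add) lincat \<Rightarrow> ('o, 'a) lie2_struct \<Rightarrow> 'o \<Rightarrow> 'o \<Rightarrow> 'o \<Rightarrow> 'a" where
  "jctr_hat L B x y z = inv_arrow L (jctr B x y z) - idt L (lbo B y (lbo B x z))"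

text \<open>
  A bilinear functor is a functor of two variables (so it preserves composition of pairs of
  arrows, \<open>bracket_cmp\<close>) that is bilinear on objects and on arrows.  The interchange law
  \<open>bracket_cmp\<close> is what corresponds to \<open>[da, b] = [a, db]\<close> on the normalized complex.
\<close>

locale lie_2_algebra = linear_category L
  for L :: "('k::field, 'o::ab_group_add, 'a::ab_group_add) lincat" +
  fixes B :: "('o, 'a) lie2_struct"
  assumes bracket_ob: "bilinear_map (Ob L) (Ob L) (Ob L) (lbo B)"
    and bracket_ar: "bilinear_map (Ar L) (Ar L) (Ar L) (lba B)"
    and bracket_src: "f \<in> carr (Ar L) \<Longrightarrow> g \<in> carr (Ar L) \<Longrightarrow>
      src L (lba B f g) = lbo B (src L f) (src L g)"
    and bracket_tgt: "f \<in> carr (Ar L) \<Longrightarrow> g \<in> carr (Ar L) \<Longrightarrow>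
      tgt L (lba B f g) = lbo B (tgt L f) (tgt L g)"
    and bracket_idt: "x \<in> carr (Ob L) \<Longrightarrow> y \<in> carr (Ob L) \<Longrightarrow>
      lba B (idt L x) (idt L y) = idt L (lbo B x y)"
    and bracket_cmp: "composable L f' f \<Longrightarrow> composable L g' g \<Longrightarrow>
      lba B (cmp L f' f) (cmp L g' g) = cmp L (lba B f' g') (lba B f g)"
    and S_bilinear: "bilinear_map (Ob L) (Ob L) (Ar L) (altr B)"
    and S_arrow: "x \<in> carr (Ob L) \<Longrightarrow> y \<in> carr (Ob L) \<Longrightarrow>
      arrow_in L (altr B x y) (lbo B x y) (- lbo B y x)"
    and S_natural: "f \<in> carr (Ar L) \<Longrightarrow> g \<in> carr (Ar L) \<Longrightarrow>
      cmp L (altr B (tgt L f) (tgt L g)) (lba B f g)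
      = cmp L (- lba B g f) (altr B (src L f) (src L g))"
    and J_trilinear: "trilinear_map (Ob L) (Ob L) (Ob L) (Ar L) (jctr B)"
    and J_arrow: "x \<in> carr (Ob L) \<Longrightarrow> y \<in> carr (Ob L) \<Longrightarrow> z \<in> carr (Ob L) \<Longrightarrow>
      arrow_in L (jctr B x y z)
        (lbo B x (lbo B y z)) (lbo B (lbo B x y) z + lbo B y (lbo B x z))"
    and J_natural: "f \<in> carr (Ar L) \<Longrightarrow> g \<in> carr (Ar L) \<Longrightarrow> h \<in> carr (Ar L) \<Longrightarrow>
      cmp L (jctr B (tgt L f) (tgt L g) (tgt L h)) (lba B f (lba B g h))
      = cmp L (lba B (lba B f g) h + lba B g (lba B f h))
              (jctr B (src L f) (src L g) (src L h))"
    and L1: "x \<in> carr (Ob L) \<Longrightarrow> y \<in> carr (Ob L) \<Longrightarrow> z \<in> carr (Ob L) \<Longrightarrow> w \<in> carr (Ob L) \<Longrightarrow>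
      cmp L
        (cmp L
          (lba B (jctr B x y z) (idt L w)
            + idt L (lbo B (lbo B y z) (lbo B x w))
            + idt L (lbo B (lbo B x z) (lbo B y w))
            + lba B (idt L z) (jctr B x y w))
          (jctr B x (lbo B y z) w + jctr B x z (lbo B y w)))
        (lba B (idt L x) (jctr B y z w))
      = cmp L
        (cmp L
          (idt L (lbo B (lbo B (lbo B x y) z) w)
            + idt L (lbo B z (lbo B (lbo B x y) w))
            + jctr B y (lbo B x z) w
            + jctr B y z (lbo B x w))
          (jctr B (lbo B x y) z w + lba B (idt L y) (jctr B x z w)))
        (jctr B x y (lbo B z w))"
    and L2: "x \<in> carr (Ob L) \<Longrightarrow> y \<in> carr (Ob L) \<Longrightarrow> z \<in> carr (Ob L) \<Longrightarrow>
      cmp L (- jctr_hat L B y x z) (lba B (altr B x y) (idt L z)) = jctr_hat L B x y z"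
    and L3: "x \<in> carr (Ob L) \<Longrightarrow> y \<in> carr (Ob L) \<Longrightarrow> z \<in> carr (Ob L) \<Longrightarrow>
      cmp L (- jctr B x z y) (lba B (idt L x) (altr B y z))
      = cmp L (altr B (lbo B x y) z + altr B y (lbo B x z)) (jctr B x y z)"
    and L4: "x \<in> carr (Ob L) \<Longrightarrow> y \<in> carr (Ob L) \<Longrightarrow> z \<in> carr (Ob L) \<Longrightarrow>
      cmp L (- altr B (lbo B y z) x) (altr B x (lbo B y z)) = idt L (lbo B x (lbo B y z))"


subsection \<open>The 2-category of Lie 2-algebras\<close>

locale lie2_morphism = dom: lie_2_algebra L B + cod: lie_2_algebra L' B'
  for L :: "('k::field, 'o::ab_group_add, 'a::ab_group_add) lincat"
    and B :: "('o, 'a) lie2_struct"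
    and L' :: "('k, 'p::ab_group_add, 'b::ab_group_add) lincat"
    and B' :: "('p, 'b) lie2_struct" +
  fixes F :: "('o, 'a, 'p, 'b) ftor"
    and F2 :: "'o \<Rightarrow> 'o \<Rightarrow> 'b"
  assumes F_functor: "linear_functor L L' F"
    and F2_bilinear: "bilinear_map (Ob L) (Ob L) (Ar L') F2"
    and F2_arrow: "x \<in> carr (Ob L) \<Longrightarrow> y \<in> carr (Ob L) \<Longrightarrow>
      arrow_in L' (F2 x y) (lbo B' (fob F x) (fob F y)) (fob F (lbo B x y))"
    and F2_natural: "f \<in> carr (Ar L) \<Longrightarrow> g \<in> carr (Ar L) \<Longrightarrow>
      cmp L' (F2 (tgt L f) (tgt L g)) (lba B' (far F f) (far F g))
      = cmp L' (far F (lba B f g)) (F2 (src L f) (src L g))"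
    and F2_S: "x \<in> carr (Ob L) \<Longrightarrow> y \<in> carr (Ob L) \<Longrightarrow>
      cmp L' (far F (altr B x y)) (F2 x y)
      = cmp L' (- F2 y x) (altr B' (fob F x) (fob F y))"
    and F2_J: "x \<in> carr (Ob L) \<Longrightarrow> y \<in> carr (Ob L) \<Longrightarrow> z \<in> carr (Ob L) \<Longrightarrow>
      cmp L' (cmp L' (far F (jctr B x y z)) (F2 x (lbo B y z)))
             (lba B' (idt L' (fob F x)) (F2 y z))
      = cmp L' (cmp L' (F2 (lbo B x y) z + F2 y (lbo B x z))
                       (lba B' (F2 x y) (idt L' (fob F z)) + lba B' (idt L' (fob F y)) (F2 x z)))
               (jctr B' (fob F x) (fob F y) (fob F z))"

definition lie2_id2 :: "('k, 'o, 'a) lincat \<Rightarrow> ('o, 'a) lie2_struct \<Rightarrow> 'o \<Rightarrow> 'o \<Rightarrow> 'a" where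
  "lie2_id2 L B x y = idt L (lbo B x y)"

text \<open>
  The second component of the composite of \<open>(F, F2) : L \<rightarrow> L'\<close> and \<open>(G, G2) : L' \<rightarrow> L''\<close>; the
  first argument is the linear category \<open>L''\<close>, in which the arrows are composed.
\<close>

definition lie2_comp2 ::
  "('k, 'q, 'c) lincat \<Rightarrow> ('p, 'b, 'q, 'c) ftor \<Rightarrow> ('p \<Rightarrow> 'p \<Rightarrow> 'c) \<Rightarrow>
   ('o, 'a, 'p, 'b) ftor \<Rightarrow> ('o \<Rightarrow> 'o \<Rightarrow> 'b) \<Rightarrow> 'o \<Rightarrow> 'o \<Rightarrow> 'c" where
  "lie2_comp2 L'' G G2 F F2 x y = cmp L'' (far G (F2 x y)) (G2 (fob F x) (fob F y))"

definition lie2_2morphism ::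
  "('k, 'o::ab_group_add, 'a) lincat \<Rightarrow> ('o, 'a) lie2_struct \<Rightarrow>
   ('k, 'p, 'b::ab_group_add) lincat \<Rightarrow> ('p, 'b) lie2_struct \<Rightarrow>
   ('o, 'a, 'p, 'b) ftor \<Rightarrow> ('o \<Rightarrow> 'o \<Rightarrow> 'b) \<Rightarrow>
   ('o, 'a, 'p, 'b) ftor \<Rightarrow> ('o \<Rightarrow> 'o \<Rightarrow> 'b) \<Rightarrow> ('o \<Rightarrow> 'b) \<Rightarrow> bool" where
  "lie2_2morphism L B L' B' F F2 G G2 \<Theta> \<longleftrightarrow>
     linear_nat_trans L L' F G \<Theta> \<and>
     (\<forall>x\<in>carr (Ob L). \<forall>y\<in>carr (Ob L).
        cmp L' (\<Theta> (lbo B x y)) (F2 x y) = cmp L' (G2 x y) (lba B' (\<Theta> x) (\<Theta> y)))"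

definition lie2_isomorphic_1morphisms ::
  "('k, 'o::ab_group_add, 'a) lincat \<Rightarrow> ('o, 'a) lie2_struct \<Rightarrow>
   ('k, 'p, 'b::ab_group_add) lincat \<Rightarrow> ('p, 'b) lie2_struct \<Rightarrow>
   ('o, 'a, 'p, 'b) ftor \<Rightarrow> ('o \<Rightarrow> 'o \<Rightarrow> 'b) \<Rightarrow>
   ('o, 'a, 'p, 'b) ftor \<Rightarrow> ('o \<Rightarrow> 'o \<Rightarrow> 'b) \<Rightarrow> bool" where
  "lie2_isomorphic_1morphisms L B L' B' F F2 G G2 \<longleftrightarrow>
     (\<exists>\<Theta> \<Phi>. lie2_2morphism L B L' B' F F2 G G2 \<Theta> \<and> lie2_2morphism L B L' B' G G2 F F2 \<Phi> \<and>
        (\<forall>x\<in>carr (Ob L). cmp L' (\<Phi> x) (\<Theta> x) = idt L' (fob F x) \<and>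
                            cmp L' (\<Theta> x) (\<Phi> x) = idt L' (fob G x)))"

definition lie2_equivalence ::
  "('k::field, 'o::ab_group_add, 'a::ab_group_add) lincat \<Rightarrow> ('o, 'a) lie2_struct \<Rightarrow>
   ('k, 'p::ab_group_add, 'b::ab_group_add) lincat \<Rightarrow> ('p, 'b) lie2_struct \<Rightarrow>
   ('o, 'a, 'p, 'b) ftor \<Rightarrow> ('o \<Rightarrow> 'o \<Rightarrow> 'b) \<Rightarrow> bool" where
  "lie2_equivalence L B L' B' F F2 \<longleftrightarrow>
     lie2_morphism L B L' B' F F2 \<and>
     (\<exists>G G2. lie2_morphism L' B' L B G G2 \<and>
        lie2_isomorphic_1morphisms L B L B
          (comp_ftor G F) (lie2_comp2 L G G2 F F2) id_ftor (lie2_id2 L B) \<and>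
        lie2_isomorphic_1morphisms L' B' L' B'
          (comp_ftor F G) (lie2_comp2 L' F F2 G G2) id_ftor (lie2_id2 L' B'))"

definition lie2_equivalent ::
  "('k::field, 'o::ab_group_add, 'a::ab_group_add) lincat \<Rightarrow> ('o, 'a) lie2_struct \<Rightarrow>
   ('k, 'p::ab_group_add, 'b::ab_group_add) lincat \<Rightarrow> ('p, 'b) lie2_struct \<Rightarrow> bool" where
  "lie2_equivalent L B L' B' \<longleftrightarrow> (\<exists>F F2. lie2_equivalence L B L' B' F F2)"


section \<open>2-term cochain complexes\<close>

record ('k, 'o, 'a) cplx2 =
  C0 :: "('k, 'o) vspace"
  C1 :: "('k, 'a) vspace"  \<comment> \<open>the space in degree \<open>-1\<close>\<close>
  dif :: "'a \<Rightarrow> 'o"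

locale two_term_complex =
  fixes C :: "('k::field, 'o::ab_group_add, 'a::ab_group_add) cplx2"
  assumes C0_vspace: "is_vspace (C0 C)"
    and C1_vspace: "is_vspace (C1 C)"
    and dif_linear: "linear_map (C1 C) (C0 C) (dif C)"

record ('o, 'a, 'p, 'b) cmap =
  m0 :: "'o \<Rightarrow> 'p"
  m1 :: "'a \<Rightarrow> 'b"  \<comment> \<open>the component in degree \<open>-1\<close>\<close>

definition chain_map ::
  "('k, 'o::ab_group_add, 'a::ab_group_add) cplx2 \<Rightarrow>
   ('k, 'p::ab_group_add, 'b::ab_group_add) cplx2 \<Rightarrow> ('o, 'a, 'p, 'b) cmap \<Rightarrow> bool" where
  "chain_map C C' f \<longleftrightarrow>
     linear_map (C0 C) (C0 C') (m0 f) \<and> linear_map (C1 C) (C1 C') (m1 f) \<and>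
     (\<forall>a\<in>carr (C1 C). m0 f (dif C a) = dif C' (m1 f a))"

definition cohom_rel :: "('k, 'o::ab_group_add, 'a) cplx2 \<Rightarrow> ('o \<times> 'o) set" where
  "cohom_rel C = {(x, y). x \<in> carr (C0 C) \<and> y \<in> carr (C0 C) \<and> x - y \<in> dif C ` carr (C1 C)}"

definition H0 :: "('k, 'o::ab_group_add, 'a) cplx2 \<Rightarrow> 'o set set" where
  "H0 C = carr (C0 C) // cohom_rel C"

definition Hm1 :: "('k, 'o::ab_group_add, 'a) cplx2 \<Rightarrow> 'a set" where
  "Hm1 C = {a \<in> carr (C1 C). dif C a = 0}"

definition H0_map ::
  "('k, 'p::ab_group_add, 'b) cplx2 \<Rightarrow> ('o, 'a, 'p, 'b) cmap \<Rightarrow> 'o set \<Rightarrow> 'p set" where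
  "H0_map C' f X = (\<Union>x\<in>X. cohom_rel C' `` {m0 f x})"

text \<open>The induced linear maps on cohomology are isomorphisms as soon as they are bijective.\<close>

definition quasi_iso ::
  "('k, 'o::ab_group_add, 'a::ab_group_add) cplx2 \<Rightarrow>
   ('k, 'p::ab_group_add, 'b::ab_group_add) cplx2 \<Rightarrow> ('o, 'a, 'p, 'b) cmap \<Rightarrow> bool" where
  "quasi_iso C C' f \<longleftrightarrow> chain_map C C' f \<and>
     bij_betw (H0_map C' f) (H0 C) (H0 C') \<and> bij_betw (m1 f) (Hm1 C) (Hm1 C')"

definition id_cmap :: "('o, 'a, 'o, 'a) cmap" where
  "id_cmap = \<lparr>m0 = (\<lambda>x. x), m1 = (\<lambda>a. a)\<rparr>"

definition comp_cmap ::
  "('p, 'b, 'q, 'c) cmap \<Rightarrow> ('o, 'a, 'p, 'b) cmap \<Rightarrow> ('o, 'a, 'q, 'c) cmap" where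
  "comp_cmap g f = \<lparr>m0 = m0 g \<circ> m0 f, m1 = m1 g \<circ> m1 f\<rparr>"


section \<open>2-term \<open>EL\<^sub>\<infinity>\<close>-algebras\<close>

record ('o, 'a) el_struct =
  br00 :: "'o \<Rightarrow> 'o \<Rightarrow> 'o"
  br01 :: "'o \<Rightarrow> 'a \<Rightarrow> 'a"
  br10 :: "'a \<Rightarrow> 'o \<Rightarrow> 'a"
  alt :: "'o \<Rightarrow> 'o \<Rightarrow> 'a"  \<comment> \<open>\<open>\<langle>x, y\<rangle>\<close>\<close>
  jac :: "'o \<Rightarrow> 'o \<Rightarrow> 'o \<Rightarrow> 'a"  \<comment> \<open>\<open>\<langle>x, y, z\<rangle>\<close>\<close>

definition br11 ::
  "('k, 'o, 'a) cplx2 \<Rightarrow> ('o, 'a) el_struct \<Rightarrow> 'a \<Rightarrow> 'a \<Rightarrow> 'a" where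
  "br11 C E a b = br01 E (dif C a) b"

locale el_algebra = two_term_complex C
  for C :: "('k::field, 'o::ab_group_add, 'a::ab_group_add) cplx2" +
  fixes E :: "('o, 'a) el_struct"
  assumes br00_bilinear: "bilinear_map (C0 C) (C0 C) (C0 C) (br00 E)"
    and br01_bilinear: "bilinear_map (C0 C) (C1 C) (C1 C) (br01 E)"
    and br10_bilinear: "bilinear_map (C1 C) (C0 C) (C1 C) (br10 E)"
    and alt_bilinear: "bilinear_map (C0 C) (C0 C) (C1 C) (alt E)"
    and jac_trilinear: "trilinear_map (C0 C) (C0 C) (C0 C) (C1 C) (jac E)"
    and dif_br01: "x \<in> carr (C0 C) \<Longrightarrow> b \<in> carr (C1 C) \<Longrightarrow>
      dif C (br01 E x b) = br00 E x (dif C b)"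
    and dif_br10: "a \<in> carr (C1 C) \<Longrightarrow> y \<in> carr (C0 C) \<Longrightarrow>
      dif C (br10 E a y) = br00 E (dif C a) y"
    and br_dif: "a \<in> carr (C1 C) \<Longrightarrow> b \<in> carr (C1 C) \<Longrightarrow>
      br01 E (dif C a) b = br10 E a (dif C b)"
    and alt_00: "x \<in> carr (C0 C) \<Longrightarrow> y \<in> carr (C0 C) \<Longrightarrow>
      br00 E x y + br00 E y x = dif C (alt E x y)"
    and alt_10: "a \<in> carr (C1 C) \<Longrightarrow> y \<in> carr (C0 C) \<Longrightarrow>
      br10 E a y + br01 E y a = alt E (dif C a) y"
    and alt_01: "x \<in> carr (C0 C) \<Longrightarrow> b \<in> carr (C1 C) \<Longrightarrow>
      br01 E x b + br10 E b x = alt E x (dif C b)"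
    and jac_000: "x \<in> carr (C0 C) \<Longrightarrow> y \<in> carr (C0 C) \<Longrightarrow> z \<in> carr (C0 C) \<Longrightarrow>
      br00 E x (br00 E y z) - br00 E (br00 E x y) z - br00 E y (br00 E x z)
      = dif C (jac E x y z)"
    and jac_100: "a \<in> carr (C1 C) \<Longrightarrow> y \<in> carr (C0 C) \<Longrightarrow> z \<in> carr (C0 C) \<Longrightarrow>
      br10 E a (br00 E y z) - br10 E (br10 E a y) z - br01 E y (br10 E a z)
      = jac E (dif C a) y z"
    and jac_010: "x \<in> carr (C0 C) \<Longrightarrow> b \<in> carr (C1 C) \<Longrightarrow> z \<in> carr (C0 C) \<Longrightarrow>
      br01 E x (br10 E b z) - br10 E (br01 E x b) z - br10 E b (br00 E x z)
      = jac E x (dif C b) z"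
    and jac_001: "x \<in> carr (C0 C) \<Longrightarrow> y \<in> carr (C0 C) \<Longrightarrow> c \<in> carr (C1 C) \<Longrightarrow>
      br01 E x (br01 E y c) - br01 E (br00 E x y) c - br01 E y (br01 E x c)
      = jac E x y (dif C c)"
    and coh_jac: "x \<in> carr (C0 C) \<Longrightarrow> y \<in> carr (C0 C) \<Longrightarrow> z \<in> carr (C0 C) \<Longrightarrow> w \<in> carr (C0 C) \<Longrightarrow>
      br01 E x (jac E y z w) + jac E x (br00 E y z) w + jac E x z (br00 E y w)
        + br10 E (jac E x y z) w + br01 E z (jac E x y w)
      = jac E x y (br00 E z w) + jac E (br00 E x y) z w + br01 E y (jac E x z w)
        + jac E y (br00 E x z) w + jac E y z (br00 E x w)"
    and coh_alt_left: "x \<in> carr (C0 C) \<Longrightarrow> y \<in> carr (C0 C) \<Longrightarrow> z \<in> carr (C0 C) \<Longrightarrow>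
      jac E x y z + jac E y x z = - br10 E (alt E x y) z"
    and coh_alt_right: "x \<in> carr (C0 C) \<Longrightarrow> y \<in> carr (C0 C) \<Longrightarrow> z \<in> carr (C0 C) \<Longrightarrow>
      jac E x y z + jac E x z y
      = br01 E x (alt E y z) - alt E (br00 E x y) z - alt E y (br00 E x z)"
    and coh_alt_sym: "x \<in> carr (C0 C) \<Longrightarrow> y \<in> carr (C0 C) \<Longrightarrow> z \<in> carr (C0 C) \<Longrightarrow>
      alt E x (br00 E y z) = alt E (br00 E y z) x"


subsection \<open>The 2-category of 2-term \<open>EL\<^sub>\<infinity>\<close>-algebras\<close>

locale el_morphism = dom: el_algebra C E + cod: el_algebra C' E'
  for C :: "('k::field, 'o::ab_group_add, 'a::ab_group_add) cplx2"
    and E :: "('o, 'a) el_struct"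
    and C' :: "('k, 'p::ab_group_add, 'b::ab_group_add) cplx2"
    and E' :: "('p, 'b) el_struct" +
  fixes f :: "('o, 'a, 'p, 'b) cmap"
    and f2 :: "'o \<Rightarrow> 'o \<Rightarrow> 'b"
  assumes chain: "chain_map C C' f"
    and f2_bilinear: "bilinear_map (C0 C) (C0 C) (C1 C') f2"
    and f2_00: "x \<in> carr (C0 C) \<Longrightarrow> y \<in> carr (C0 C) \<Longrightarrow>
      br00 E' (m0 f x) (m0 f y) - m0 f (br00 E x y) = dif C' (f2 x y)"
    and f2_10: "a \<in> carr (C1 C) \<Longrightarrow> y \<in> carr (C0 C) \<Longrightarrow>
      br10 E' (m1 f a) (m0 f y) - m1 f (br10 E a y) = f2 (dif C a) y"
    and f2_01: "x \<in> carr (C0 C) \<Longrightarrow> b \<in> carr (C1 C) \<Longrightarrow>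
      br01 E' (m0 f x) (m1 f b) - m1 f (br01 E x b) = f2 x (dif C b)"
    and f2_alt: "x \<in> carr (C0 C) \<Longrightarrow> y \<in> carr (C0 C) \<Longrightarrow>
      alt E' (m0 f x) (m0 f y) - m1 f (alt E x y) = f2 x y + f2 y x"
    and f2_jac: "x \<in> carr (C0 C) \<Longrightarrow> y \<in> carr (C0 C) \<Longrightarrow> z \<in> carr (C0 C) \<Longrightarrow>
      jac E' (m0 f x) (m0 f y) (m0 f z) - m1 f (jac E x y z)
      = br01 E' (m0 f x) (f2 y z) - br01 E' (m0 f y) (f2 x z) - br10 E' (f2 x y) (m0 f z)
        - f2 (br00 E x y) z - f2 y (br00 E x z) + f2 x (br00 E y z)"

definition el_id2 :: "'o \<Rightarrow> 'o \<Rightarrow> 'a::ab_group_add" where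
  "el_id2 x y = 0"

definition el_comp2 ::
  "('p, 'b, 'q, 'c::ab_group_add) cmap \<Rightarrow> ('p \<Rightarrow> 'p \<Rightarrow> 'c) \<Rightarrow>
   ('o, 'a, 'p, 'b) cmap \<Rightarrow> ('o \<Rightarrow> 'o \<Rightarrow> 'b) \<Rightarrow> 'o \<Rightarrow> 'o \<Rightarrow> 'c" where
  "el_comp2 g g2 f f2 x y = g2 (m0 f x) (m0 f y) + m1 g (f2 x y)"

definition el_2morphism ::
  "('k, 'o::ab_group_add, 'a) cplx2 \<Rightarrow> ('o, 'a) el_struct \<Rightarrow>
   ('k, 'p::ab_group_add, 'b::ab_group_add) cplx2 \<Rightarrow> ('p, 'b) el_struct \<Rightarrow>
   ('o, 'a, 'p, 'b) cmap \<Rightarrow> ('o \<Rightarrow> 'o \<Rightarrow> 'b) \<Rightarrow>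
   ('o, 'a, 'p, 'b) cmap \<Rightarrow> ('o \<Rightarrow> 'o \<Rightarrow> 'b) \<Rightarrow> ('o \<Rightarrow> 'b) \<Rightarrow> bool" where
  "el_2morphism C E C' E' f f2 g g2 \<theta> \<longleftrightarrow>
     linear_map (C0 C) (C1 C') \<theta> \<and>
     (\<forall>x\<in>carr (C0 C). m0 f x - m0 g x = dif C' (\<theta> x)) \<and>
     (\<forall>a\<in>carr (C1 C). m1 f a - m1 g a = \<theta> (dif C a)) \<and>
     (\<forall>x\<in>carr (C0 C). \<forall>y\<in>carr (C0 C).
        f2 x y - g2 x y
        = br01 E' (m0 f x) (\<theta> y) + br10 E' (\<theta> x) (m0 f y) - \<theta> (br00 E x y)
          - br11 C' E' (\<theta> x) (\<theta> y))"

text \<open>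
  2-morphisms compose as chain homotopies, by addition, and the identity 2-morphism is \<open>0\<close>; so
  two 2-morphisms are mutually inverse iff their sum vanishes.
\<close>

definition el_isomorphic_1morphisms ::
  "('k, 'o::ab_group_add, 'a) cplx2 \<Rightarrow> ('o, 'a) el_struct \<Rightarrow>
   ('k, 'p::ab_group_add, 'b::ab_group_add) cplx2 \<Rightarrow> ('p, 'b) el_struct \<Rightarrow>
   ('o, 'a, 'p, 'b) cmap \<Rightarrow> ('o \<Rightarrow> 'o \<Rightarrow> 'b) \<Rightarrow>
   ('o, 'a, 'p, 'b) cmap \<Rightarrow> ('o \<Rightarrow> 'o \<Rightarrow> 'b) \<Rightarrow> bool" where
  "el_isomorphic_1morphisms C E C' E' f f2 g g2 \<longleftrightarrow>
     (\<exists>\<theta> \<phi>. el_2morphism C E C' E' f f2 g g2 \<theta> \<and> el_2morphism C E C' E' g g2 f f2 \<phi> \<and>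
        (\<forall>x\<in>carr (C0 C). \<theta> x + \<phi> x = 0))"

definition el_equivalence ::
  "('k::field, 'o::ab_group_add, 'a::ab_group_add) cplx2 \<Rightarrow> ('o, 'a) el_struct \<Rightarrow>
   ('k, 'p::ab_group_add, 'b::ab_group_add) cplx2 \<Rightarrow> ('p, 'b) el_struct \<Rightarrow>
   ('o, 'a, 'p, 'b) cmap \<Rightarrow> ('o \<Rightarrow> 'o \<Rightarrow> 'b) \<Rightarrow> bool" where
  "el_equivalence C E C' E' f f2 \<longleftrightarrow>
     el_morphism C E C' E' f f2 \<and>
     (\<exists>g g2. el_morphism C' E' C E g g2 \<and>
        el_isomorphic_1morphisms C E C E
          (comp_cmap g f) (el_comp2 g g2 f f2) id_cmap el_id2 \<and>
        el_isomorphic_1morphisms C' E' C' E'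
          (comp_cmap f g) (el_comp2 f f2 g g2) id_cmap el_id2)"

definition el_equivalent ::
  "('k::field, 'o::ab_group_add, 'a::ab_group_add) cplx2 \<Rightarrow> ('o, 'a) el_struct \<Rightarrow>
   ('k, 'p::ab_group_add, 'b::ab_group_add) cplx2 \<Rightarrow> ('p, 'b) el_struct \<Rightarrow> bool" where
  "el_equivalent C E C' E' \<longleftrightarrow> (\<exists>f f2. el_equivalence C E C' E' f f2)"

end

theory Submission
  imports Defs
begin

text \<open>
  Over a field a quasi-isomorphism \<open>f\<close> has a linear homotopy inverse \<open>g\<close> with homotopies
  \<open>f g = 1 + d h\<close>, \<open>g f = 1 + d k\<close> that can be chosen coherently (\<open>f k = h f\<close>).  The structure on
  \<open>C'\<close> is obtained by conjugating the brackets with \<open>f\<close> and \<open>g\<close> and correcting the Jacobiator by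
  terms in \<open>k\<close>.  An \<open>EL\<^sub>\<infinity>\<close>-morphism \<open>(f, f2)\<close> over such an \<open>f\<close> is an equivalence: \<open>1 + d h\<close>
  underlies an endomorphism of \<open>C'\<close> homotopic to the identity, and an element \<open>a\<close> of degree \<open>-1\<close> in
  \<open>C\<close> is determined by \<open>d a\<close> and \<open>f a\<close>, so the second component of \<open>g\<close> can be read off and its
  axioms checked after applying \<open>d\<close> and \<open>f\<close>.  Two structures transferred along the same \<open>f\<close> are
  compared by the composite of an inverse of the first morphism with the second one, which is
  homotopic to the identity of \<open>C'\<close>.

  Lie 2-algebras reduce to this because composition in a linear category is
  \<open>g \<circ> f = g + f - 1\<close>, where \<open>1\<close> is the identity of the middle object, so that all arrow equations
  become linear equations in the kernel of the source map.  A skeletal model is the full subcategory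
  on a complement of the image of \<open>d\<close>.
\<close>

section \<open>Linear algebra on carriers\<close>

lemma is_vspace_simps:
  fixes V :: "('k::field, 'v::ab_group_add) vspace"
  assumes "is_vspace V"
  shows "0 \<in> carr V"
    and "x \<in> carr V \<Longrightarrow> y \<in> carr V \<Longrightarrow> x + y \<in> carr V"
    and "x \<in> carr V \<Longrightarrow> y \<in> carr V \<Longrightarrow> x - y \<in> carr V"
    and "x \<in> carr V \<Longrightarrow> - x \<in> carr V"
    and "x \<in> carr V \<Longrightarrow> smul V c x \<in> carr V"
    and "smul V c 0 = 0"
    and "smul V c (x + y) = smul V c x + smul V c y"
    and "smul V c (x - y) = smul V c x - smul V c y"
    and "smul V c (- x) = - smul V c x"
proof -
  interpret vector_space "smul V"
    using assms by (simp add: is_vspace_def)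
  have "subspace (carr V)"
    using assms by (simp add: is_vspace_def)
  then show "0 \<in> carr V"
    and "x \<in> carr V \<Longrightarrow> y \<in> carr V \<Longrightarrow> x + y \<in> carr V"
    and "x \<in> carr V \<Longrightarrow> y \<in> carr V \<Longrightarrow> x - y \<in> carr V"
    and "x \<in> carr V \<Longrightarrow> - x \<in> carr V"
    and "x \<in> carr V \<Longrightarrow> smul V c x \<in> carr V"
    by (simp_all add: subspace_0 subspace_add subspace_diff subspace_neg subspace_scale)
  show "smul V c 0 = 0" "smul V c (x + y) = smul V c x + smul V c y"
    "smul V c (x - y) = smul V c x - smul V c y" "smul V c (- x) = - smul V c x"
    by (simp_all add: scale_right_distrib scale_right_diff_distrib)
qed

lemma linear_map_simps:
  assumes f: "linear_map V W f" and V: "is_vspace V"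
  shows "x \<in> carr V \<Longrightarrow> f x \<in> carr W"
    and "f 0 = 0"
    and "x \<in> carr V \<Longrightarrow> y \<in> carr V \<Longrightarrow> f (x + y) = f x + f y"
    and "x \<in> carr V \<Longrightarrow> y \<in> carr V \<Longrightarrow> f (x - y) = f x - f y"
    and "x \<in> carr V \<Longrightarrow> f (- x) = - f x"
    and "x \<in> carr V \<Longrightarrow> f (smul V c x) = smul W c (f x)"
proof -
  note [simp] = is_vspace_simps[OF V]
  show "x \<in> carr V \<Longrightarrow> f x \<in> carr W" "x \<in> carr V \<Longrightarrow> f (smul V c x) = smul W c (f x)" for x
    using f by (auto simp: linear_map_def)
  have add: "f (x + y) = f x + f y" if "x \<in> carr V" "y \<in> carr V" for x y
    using f that by (auto simp: linear_map_def)
  then show "x \<in> carr V \<Longrightarrow> y \<in> carr V \<Longrightarrow> f (x + y) = f x + f y" .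
  show f0: "f 0 = 0"
    using add[of 0 0] by simp
  have neg: "f (- x) = - f x" if "x \<in> carr V" for x
    using add[of x "- x"] that f0 by (simp add: eq_neg_iff_add_eq_0 add.commute)
  then show "x \<in> carr V \<Longrightarrow> f (- x) = - f x" .
  show "x \<in> carr V \<Longrightarrow> y \<in> carr V \<Longrightarrow> f (x - y) = f x - f y"
    using add[of x "- y"] neg[of y] by simp
qed

lemma bilinear_map_simps:
  assumes f: "bilinear_map U V W f" and U: "is_vspace U" and V: "is_vspace V"
  shows "x \<in> carr U \<Longrightarrow> y \<in> carr V \<Longrightarrow> f x y \<in> carr W"
    and "y \<in> carr V \<Longrightarrow> f 0 y = 0"
    and "x \<in> carr U \<Longrightarrow> f x 0 = 0"
    and "x \<in> carr U \<Longrightarrow> x' \<in> carr U \<Longrightarrow> y \<in> carr V \<Longrightarrow> f (x + x') y = f x y + f x' y"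
    and "x \<in> carr U \<Longrightarrow> y \<in> carr V \<Longrightarrow> y' \<in> carr V \<Longrightarrow> f x (y + y') = f x y + f x y'"
    and "x \<in> carr U \<Longrightarrow> x' \<in> carr U \<Longrightarrow> y \<in> carr V \<Longrightarrow> f (x - x') y = f x y - f x' y"
    and "x \<in> carr U \<Longrightarrow> y \<in> carr V \<Longrightarrow> y' \<in> carr V \<Longrightarrow> f x (y - y') = f x y - f x y'"
    and "x \<in> carr U \<Longrightarrow> y \<in> carr V \<Longrightarrow> f (- x) y = - f x y"
    and "x \<in> carr U \<Longrightarrow> y \<in> carr V \<Longrightarrow> f x (- y) = - f x y"
    and "x \<in> carr U \<Longrightarrow> y \<in> carr V \<Longrightarrow> f (smul U c x) y = smul W c (f x y)"
    and "x \<in> carr U \<Longrightarrow> y \<in> carr V \<Longrightarrow> f x (smul V c y) = smul W c (f x y)"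
proof -
  have r: "linear_map V W (f x)" if "x \<in> carr U" for x
    using f that by (simp add: bilinear_map_def)
  have l: "linear_map U W (\<lambda>x. f x y)" if "y \<in> carr V" for y
    using f that by (simp add: bilinear_map_def)
  show "x \<in> carr U \<Longrightarrow> y \<in> carr V \<Longrightarrow> f x y \<in> carr W"
    "x \<in> carr U \<Longrightarrow> f x 0 = 0"
    "x \<in> carr U \<Longrightarrow> y \<in> carr V \<Longrightarrow> y' \<in> carr V \<Longrightarrow> f x (y + y') = f x y + f x y'"
    "x \<in> carr U \<Longrightarrow> y \<in> carr V \<Longrightarrow> y' \<in> carr V \<Longrightarrow> f x (y - y') = f x y - f x y'"
    "x \<in> carr U \<Longrightarrow> y \<in> carr V \<Longrightarrow> f x (- y) = - f x y"
    "x \<in> carr U \<Longrightarrow> y \<in> carr V \<Longrightarrow> f x (smul V c y) = smul W c (f x y)"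
    by (simp_all add: linear_map_simps[OF r V])
  show "y \<in> carr V \<Longrightarrow> f 0 y = 0"
    "x \<in> carr U \<Longrightarrow> x' \<in> carr U \<Longrightarrow> y \<in> carr V \<Longrightarrow> f (x + x') y = f x y + f x' y"
    "x \<in> carr U \<Longrightarrow> x' \<in> carr U \<Longrightarrow> y \<in> carr V \<Longrightarrow> f (x - x') y = f x y - f x' y"
    "x \<in> carr U \<Longrightarrow> y \<in> carr V \<Longrightarrow> f (- x) y = - f x y"
    "x \<in> carr U \<Longrightarrow> y \<in> carr V \<Longrightarrow> f (smul U c x) y = smul W c (f x y)"
    by (simp_all add: linear_map_simps[OF l U])
qed

lemma trilinear_map_simps:
  assumes f: "trilinear_map T U V W f" and T: "is_vspace T" and U: "is_vspace U" and V: "is_vspace V"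
  shows "x \<in> carr T \<Longrightarrow> y \<in> carr U \<Longrightarrow> z \<in> carr V \<Longrightarrow> f x y z \<in> carr W"
    and "y \<in> carr U \<Longrightarrow> z \<in> carr V \<Longrightarrow> f 0 y z = 0"
    and "x \<in> carr T \<Longrightarrow> z \<in> carr V \<Longrightarrow> f x 0 z = 0"
    and "x \<in> carr T \<Longrightarrow> y \<in> carr U \<Longrightarrow> f x y 0 = 0"
    and "x \<in> carr T \<Longrightarrow> x' \<in> carr T \<Longrightarrow> y \<in> carr U \<Longrightarrow> z \<in> carr V \<Longrightarrow>
      f (x + x') y z = f x y z + f x' y z"
    and "x \<in> carr T \<Longrightarrow> y \<in> carr U \<Longrightarrow> y' \<in> carr U \<Longrightarrow> z \<in> carr V \<Longrightarrow>
      f x (y + y') z = f x y z + f x y' z"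
    and "x \<in> carr T \<Longrightarrow> y \<in> carr U \<Longrightarrow> z \<in> carr V \<Longrightarrow> z' \<in> carr V \<Longrightarrow>
      f x y (z + z') = f x y z + f x y z'"
    and "x \<in> carr T \<Longrightarrow> x' \<in> carr T \<Longrightarrow> y \<in> carr U \<Longrightarrow> z \<in> carr V \<Longrightarrow>
      f (x - x') y z = f x y z - f x' y z"
    and "x \<in> carr T \<Longrightarrow> y \<in> carr U \<Longrightarrow> y' \<in> carr U \<Longrightarrow> z \<in> carr V \<Longrightarrow>
      f x (y - y') z = f x y z - f x y' z"
    and "x \<in> carr T \<Longrightarrow> y \<in> carr U \<Longrightarrow> z \<in> carr V \<Longrightarrow> z' \<in> carr V \<Longrightarrow>
      f x y (z - z') = f x y z - f x y z'"
    and "x \<in> carr T \<Longrightarrow> y \<in> carr U \<Longrightarrow> z \<in> carr V \<Longrightarrow> f (- x) y z = - f x y z"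
    and "x \<in> carr T \<Longrightarrow> y \<in> carr U \<Longrightarrow> z \<in> carr V \<Longrightarrow> f x (- y) z = - f x y z"
    and "x \<in> carr T \<Longrightarrow> y \<in> carr U \<Longrightarrow> z \<in> carr V \<Longrightarrow> f x y (- z) = - f x y z"
    and "x \<in> carr T \<Longrightarrow> y \<in> carr U \<Longrightarrow> z \<in> carr V \<Longrightarrow> f (smul T c x) y z = smul W c (f x y z)"
    and "x \<in> carr T \<Longrightarrow> y \<in> carr U \<Longrightarrow> z \<in> carr V \<Longrightarrow> f x (smul U c y) z = smul W c (f x y z)"
    and "x \<in> carr T \<Longrightarrow> y \<in> carr U \<Longrightarrow> z \<in> carr V \<Longrightarrow> f x y (smul V c z) = smul W c (f x y z)"
proof -
  have 3: "linear_map V W (f x y)" if "x \<in> carr T" "y \<in> carr U" for x y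
    using f that by (simp add: trilinear_map_def)
  have 2: "linear_map U W (\<lambda>y. f x y z)" if "x \<in> carr T" "z \<in> carr V" for x z
    using f that by (simp add: trilinear_map_def)
  have 1: "linear_map T W (\<lambda>x. f x y z)" if "y \<in> carr U" "z \<in> carr V" for y z
    using f that by (simp add: trilinear_map_def)
  show "x \<in> carr T \<Longrightarrow> y \<in> carr U \<Longrightarrow> z \<in> carr V \<Longrightarrow> f x y z \<in> carr W"
    "x \<in> carr T \<Longrightarrow> y \<in> carr U \<Longrightarrow> f x y 0 = 0"
    "x \<in> carr T \<Longrightarrow> y \<in> carr U \<Longrightarrow> z \<in> carr V \<Longrightarrow> z' \<in> carr V \<Longrightarrow>
      f x y (z + z') = f x y z + f x y z'"
    "x \<in> carr T \<Longrightarrow> y \<in> carr U \<Longrightarrow> z \<in> carr V \<Longrightarrow> z' \<in> carr V \<Longrightarrow>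
      f x y (z - z') = f x y z - f x y z'"
    "x \<in> carr T \<Longrightarrow> y \<in> carr U \<Longrightarrow> z \<in> carr V \<Longrightarrow> f x y (- z) = - f x y z"
    "x \<in> carr T \<Longrightarrow> y \<in> carr U \<Longrightarrow> z \<in> carr V \<Longrightarrow> f x y (smul V c z) = smul W c (f x y z)"
    by (simp_all add: linear_map_simps[OF 3 V])
  show "x \<in> carr T \<Longrightarrow> z \<in> carr V \<Longrightarrow> f x 0 z = 0"
    "x \<in> carr T \<Longrightarrow> y \<in> carr U \<Longrightarrow> y' \<in> carr U \<Longrightarrow> z \<in> carr V \<Longrightarrow>
      f x (y + y') z = f x y z + f x y' z"
    "x \<in> carr T \<Longrightarrow> y \<in> carr U \<Longrightarrow> y' \<in> carr U \<Longrightarrow> z \<in> carr V \<Longrightarrow>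
      f x (y - y') z = f x y z - f x y' z"
    "x \<in> carr T \<Longrightarrow> y \<in> carr U \<Longrightarrow> z \<in> carr V \<Longrightarrow> f x (- y) z = - f x y z"
    "x \<in> carr T \<Longrightarrow> y \<in> carr U \<Longrightarrow> z \<in> carr V \<Longrightarrow> f x (smul U c y) z = smul W c (f x y z)"
    by (simp_all add: linear_map_simps[OF 2 U])
  show "y \<in> carr U \<Longrightarrow> z \<in> carr V \<Longrightarrow> f 0 y z = 0"
    "x \<in> carr T \<Longrightarrow> x' \<in> carr T \<Longrightarrow> y \<in> carr U \<Longrightarrow> z \<in> carr V \<Longrightarrow>
      f (x + x') y z = f x y z + f x' y z"
    "x \<in> carr T \<Longrightarrow> x' \<in> carr T \<Longrightarrow> y \<in> carr U \<Longrightarrow> z \<in> carr V \<Longrightarrow>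
      f (x - x') y z = f x y z - f x' y z"
    "x \<in> carr T \<Longrightarrow> y \<in> carr U \<Longrightarrow> z \<in> carr V \<Longrightarrow> f (- x) y z = - f x y z"
    "x \<in> carr T \<Longrightarrow> y \<in> carr U \<Longrightarrow> z \<in> carr V \<Longrightarrow> f (smul T c x) y z = smul W c (f x y z)"
    by (simp_all add: linear_map_simps[OF 1 T])
qed

text \<open>A choice made on a basis of \<open>carr V\<close> extends linearly, and closure of
  \<open>P\<close> under sums and multiples carries the relation to the span. Two outputs are
  selected together because a preimage and the homotopy witnessing it depend on each other; where
  one output is wanted, the second is a dummy.\<close>

lemma linear_selection:
  fixes V :: "('k::field, 'v::ab_group_add) vspace"
    and W :: "('k, 'w::ab_group_add) vspace" and W' :: "('k, 'u::ab_group_add) vspace"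
  assumes V: "is_vspace V" and W: "is_vspace W" and W': "is_vspace W'"
    and zero: "P 0 0 0"
    and add: "\<And>x u v y u' v'. x \<in> carr V \<Longrightarrow> u \<in> carr W \<Longrightarrow> v \<in> carr W' \<Longrightarrow> P x u v \<Longrightarrow>
      y \<in> carr V \<Longrightarrow> u' \<in> carr W \<Longrightarrow> v' \<in> carr W' \<Longrightarrow> P y u' v' \<Longrightarrow> P (x + y) (u + u') (v + v')"
    and scale: "\<And>c x u v. x \<in> carr V \<Longrightarrow> u \<in> carr W \<Longrightarrow> v \<in> carr W' \<Longrightarrow> P x u v \<Longrightarrow>
      P (smul V c x) (smul W c u) (smul W' c v)"
    and ex: "\<And>x. x \<in> carr V \<Longrightarrow> \<exists>u\<in>carr W. \<exists>v\<in>carr W'. P x u v"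
  obtains g h where "linear_map V W g" "linear_map V W' h" "\<And>x. x \<in> carr V \<Longrightarrow> P x (g x) (h x)"
proof -
  interpret V: vector_space "smul V" using V by (simp add: is_vspace_def)
  interpret W: vector_space "smul W" using W by (simp add: is_vspace_def)
  interpret W': vector_space "smul W'" using W' by (simp add: is_vspace_def)
  interpret VW: vector_space_pair "smul V" "smul W" by unfold_locales
  interpret VW': vector_space_pair "smul V" "smul W'" by unfold_locales
  note [simp] = is_vspace_simps[OF V] is_vspace_simps[OF W] is_vspace_simps[OF W']
  obtain B where B: "B \<subseteq> carr V" "V.independent B" "carr V \<subseteq> V.span B"
    using V.basis_exists[of "carr V"] by metis
  have "\<exists>p. fst p \<in> carr W \<and> snd p \<in> carr W' \<and> P b (fst p) (snd p)" if "b \<in> B" for b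
    using ex[of b] B(1) that by auto
  then obtain s where s: "\<And>b. b \<in> B \<Longrightarrow> fst (s b) \<in> carr W \<and> snd (s b) \<in> carr W' \<and> P b (fst (s b)) (snd (s b))"
    by metis
  obtain g where g: "Vector_Spaces.linear (smul V) (smul W) g" "\<forall>b\<in>B. g b = fst (s b)"
    using VW.linear_independent_extend[OF B(2), of "\<lambda>b. fst (s b)"] by blast
  obtain h where h: "Vector_Spaces.linear (smul V) (smul W') h" "\<forall>b\<in>B. h b = snd (s b)"
    using VW'.linear_independent_extend[OF B(2), of "\<lambda>b. snd (s b)"] by blast
  interpret g: Vector_Spaces.linear "smul V" "smul W" g by (rule g)
  interpret h: Vector_Spaces.linear "smul V" "smul W'" h by (rule h)
  have *: "x \<in> carr V \<and> g x \<in> carr W \<and> h x \<in> carr W' \<and> P x (g x) (h x)" if "x \<in> V.span B" for x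
    using that
  proof (induction rule: V.span_induct_alt)
    case base
    then show ?case using zero by (simp add: g.zero h.zero)
  next
    case (step c b y)
    with s[of b] B(1) g(2) h(2) have "b \<in> carr V" "g b \<in> carr W" "h b \<in> carr W'" "P b (g b) (h b)"
      by auto
    with step add scale show ?case
      by (auto simp: g.add h.add g.scale h.scale)
  qed
  show thesis
  proof (rule that)
    show "linear_map V W g" "linear_map V W' h"
      using B(3) * by (auto simp: linear_map_def g.add h.add g.scale h.scale)
    show "P x (g x) (h x)" if "x \<in> carr V" for x
      using that B(3) * by auto
  qed
qed

text \<open>The inclusion of a subspace splits over a field. The kernel of the splitting of the
  space of boundaries later provides the objects of a skeleton.\<close>

lemma linear_retraction:
  fixes V :: "('k::field, 'v::ab_group_add) vspace"
  assumes V: "is_vspace V" and S: "module.subspace (smul V) S" "S \<subseteq> carr V"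
  obtains p where "linear_map V V p" "\<And>x. x \<in> carr V \<Longrightarrow> p x \<in> S" "\<And>x. x \<in> S \<Longrightarrow> p x = x"
proof -
  interpret V: vector_space "smul V" using V by (simp add: is_vspace_def)
  interpret VV: vector_space_pair "smul V" "smul V" by unfold_locales
  obtain p where p: "p ` UNIV \<subseteq> S" "Vector_Spaces.linear (smul V) (smul V) p" "\<forall>v\<in>S. p v = v"
    using VV.linear_exists_left_inverse_on[OF V.linear_ident S(1)] by auto
  interpret p: Vector_Spaces.linear "smul V" "smul V" p by (rule p)
  show thesis
    by (rule that[of p]) (use p S(2) in \<open>auto simp: linear_map_def p.add p.scale\<close>)
qed

section \<open>Homotopy equivalences of 2-term complexes\<close>

context two_term_complex
begin

lemmas C_simps [simp] =
  is_vspace_simps[OF C0_vspace] is_vspace_simps[OF C1_vspace] linear_map_simps[OF dif_linear C1_vspace]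

end

lemma chain_mapD:
  assumes "chain_map C C' f"
  shows "linear_map (C0 C) (C0 C') (m0 f)" "linear_map (C1 C) (C1 C') (m1 f)"
    and "a \<in> carr (C1 C) \<Longrightarrow> dif C' (m1 f a) = m0 f (dif C a)"
  using assms by (simp_all add: chain_map_def)

text \<open>
  The condition \<open>f1_k\<close> makes the homotopies coherent, as in an adjoint equivalence.
\<close>

locale chain_equiv = dom: two_term_complex C + cod: two_term_complex C'
  for C :: "('k::field, 'o::ab_group_add, 'a::ab_group_add) cplx2"
    and C' :: "('k, 'p::ab_group_add, 'b::ab_group_add) cplx2" +
  fixes f :: "('o, 'a, 'p, 'b) cmap" and g :: "('p, 'b, 'o, 'a) cmap"
    and h :: "'p \<Rightarrow> 'b" and k :: "'o \<Rightarrow> 'a"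
  assumes f_chain: "chain_map C C' f"
    and g_chain: "chain_map C' C g"
    and h_linear: "linear_map (C0 C') (C1 C') h"
    and k_linear: "linear_map (C0 C) (C1 C) k"
    and fg0 [simp]: "y \<in> carr (C0 C') \<Longrightarrow> m0 f (m0 g y) = y + dif C' (h y)"
    and fg1 [simp]: "b \<in> carr (C1 C') \<Longrightarrow> m1 f (m1 g b) = b + h (dif C' b)"
    and gf0 [simp]: "x \<in> carr (C0 C) \<Longrightarrow> m0 g (m0 f x) = x + dif C (k x)"
    and gf1 [simp]: "a \<in> carr (C1 C) \<Longrightarrow> m1 g (m1 f a) = a + k (dif C a)"
    and f1_k [simp]: "x \<in> carr (C0 C) \<Longrightarrow> m1 f (k x) = h (m0 f x)"
begin

lemmas map_simps [simp] =
  linear_map_simps[OF chain_mapD(1)[OF f_chain] dom.C0_vspace]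
  linear_map_simps[OF chain_mapD(2)[OF f_chain] dom.C1_vspace]
  linear_map_simps[OF chain_mapD(1)[OF g_chain] cod.C0_vspace]
  linear_map_simps[OF chain_mapD(2)[OF g_chain] cod.C1_vspace]
  linear_map_simps[OF h_linear cod.C0_vspace]
  linear_map_simps[OF k_linear dom.C0_vspace]
  chain_mapD(3)[OF f_chain] chain_mapD(3)[OF g_chain]

text \<open>In degree -1 the homotopy gives a = g f a - k d a. Equations in \<open>C1 C\<close> can
  thus be checked after applying d and f, that is, in spaces where more is known.\<close>

lemma eq_by_f:
  assumes "a \<in> carr (C1 C)" "b \<in> carr (C1 C)" "dif C a = dif C b" "m1 f a = m1 f b"
  shows "a = b"
proof -
  have "a = m1 g (m1 f a) - k (dif C a)"
    using assms(1) by simp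
  also have "\<dots> = m1 g (m1 f b) - k (dif C b)"
    by (simp only: assms)
  also have "\<dots> = b"
    using assms(2) by simp
  finally show ?thesis .
qed

text \<open>The mirror image of \<open>f1_k\<close>, obtained by comparing differentials and images
  under f. It makes the data symmetric in the two complexes, which is what
  \<open>chain_equiv_sym\<close> needs.\<close>

lemma g1_h [simp]: "y \<in> carr (C0 C') \<Longrightarrow> m1 g (h y) = k (m0 g y)"
  by (rule eq_by_f) (use gf0[of "m0 g y"] in \<open>simp_all add: algebra_simps\<close>)

lemma g0_dh [simp]: "y \<in> carr (C0 C') \<Longrightarrow> m0 g (dif C' (h y)) = dif C (k (m0 g y))"
  using gf0[of "m0 g y"] by simp

lemma f0_dk [simp]: "x \<in> carr (C0 C) \<Longrightarrow> m0 f (dif C (k x)) = dif C' (h (m0 f x))"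
  using fg0[of "m0 f x"] by simp

lemma chain_equiv_sym: "chain_equiv C' C g f k h"
  by unfold_locales (simp_all add: f_chain g_chain h_linear k_linear)

text \<open>As f g = 1 + d h, the identity serves as a homotopy inverse of f g, and h is the
  homotopy on both sides. This is how comparison morphisms over f g are recognised as
  equivalences.\<close>

lemma chain_equiv_comp_id: "chain_equiv C' C' (comp_cmap f g) id_cmap h h"
  by unfold_locales
    (simp_all add: h_linear comp_cmap_def id_cmap_def chain_map_def linear_map_def)

end

text \<open>The three conditions say that the mapping cone of f is exact at its three places;
  \<open>lift\<close> merges injectivity on degree 0 cohomology with surjectivity on degree -1
  cohomology. Both quasi-isomorphisms and equivalences of linear categories provide them.\<close>

lemma chain_equivI:
  fixes C :: "('k::field, 'o::ab_group_add, 'a::ab_group_add) cplx2"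
    and C' :: "('k, 'p::ab_group_add, 'b::ab_group_add) cplx2"
  assumes C: "two_term_complex C" and C': "two_term_complex C'" and f: "chain_map C C' f"
    and inj: "\<And>a. a \<in> carr (C1 C) \<Longrightarrow> dif C a = 0 \<Longrightarrow> m1 f a = 0 \<Longrightarrow> a = 0"
    and lift: "\<And>x b. x \<in> carr (C0 C) \<Longrightarrow> b \<in> carr (C1 C') \<Longrightarrow> m0 f x = dif C' b \<Longrightarrow>
      \<exists>a\<in>carr (C1 C). dif C a = x \<and> m1 f a = b"
    and surj: "\<And>y. y \<in> carr (C0 C') \<Longrightarrow> \<exists>x\<in>carr (C0 C). \<exists>b\<in>carr (C1 C'). m0 f x = y + dif C' b"
  obtains g h k where "chain_equiv C C' f g h k"
proof -
  interpret dom: two_term_complex C by (rule C)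
  interpret cod: two_term_complex C' by (rule C')
  note [simp] = linear_map_simps[OF chain_mapD(1)[OF f] dom.C0_vspace]
    linear_map_simps[OF chain_mapD(2)[OF f] dom.C1_vspace] chain_mapD(3)[OF f]
  have eq_by_f: "a = b" if "a \<in> carr (C1 C)" "b \<in> carr (C1 C)" "dif C a = dif C b" "m1 f a = m1 f b" for a b
    using inj[of "a - b"] that by simp
  obtain g0 h where g0: "linear_map (C0 C') (C0 C) g0" and h: "linear_map (C0 C') (C1 C') h"
    and fg0: "\<And>y. y \<in> carr (C0 C') \<Longrightarrow> m0 f (g0 y) = y + dif C' (h y)"
    by (rule linear_selection[OF cod.C0_vspace dom.C0_vspace cod.C1_vspace,
          where P = "\<lambda>y x b. m0 f x = y + dif C' b"])
      (use surj in \<open>auto simp: algebra_simps\<close>)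
  note [simp] = linear_map_simps[OF g0 cod.C0_vspace] linear_map_simps[OF h cod.C0_vspace]
  \<comment> \<open>The values prescribed for \<open>g1 b\<close> are those of a chain map over
    \<open>g0\<close> with f g = 1 + h d. The lift exists since f maps g0 (d b) to d (b + h (d b)).
    The second output \<open>g1'\<close> is a dummy.\<close>
  obtain g1 g1' where g1: "linear_map (C1 C') (C1 C) g1" "linear_map (C1 C') (C1 C) g1'"
    and dg1: "\<And>b. b \<in> carr (C1 C') \<Longrightarrow> dif C (g1 b) = g0 (dif C' b) \<and> m1 f (g1 b) = b + h (dif C' b)"
  proof (rule linear_selection[OF cod.C1_vspace dom.C1_vspace dom.C1_vspace,
          where P = "\<lambda>b a _. dif C a = g0 (dif C' b) \<and> m1 f a = b + h (dif C' b)"])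
    show "\<exists>a\<in>carr (C1 C). \<exists>_\<in>carr (C1 C). dif C a = g0 (dif C' b) \<and> m1 f a = b + h (dif C' b)"
      if "b \<in> carr (C1 C')" for b
      using lift[of "g0 (dif C' b)" "b + h (dif C' b)"] that by (auto simp: fg0)
  qed (simp_all add: algebra_simps)
  \<comment> \<open>Applying f to g0 (f x) - x gives d (h (f x)), so \<open>lift\<close> can
    prescribe f (k x) = h (f x) as well: the coherence condition is built into the choice of
    \<open>k\<close>.\<close>
  obtain k k' where k: "linear_map (C0 C) (C1 C) k" "linear_map (C0 C) (C1 C) k'"
    and dk: "\<And>x. x \<in> carr (C0 C) \<Longrightarrow> g0 (m0 f x) = x + dif C (k x) \<and> m1 f (k x) = h (m0 f x)"
  proof (rule linear_selection[OF dom.C0_vspace dom.C1_vspace dom.C1_vspace,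
          where P = "\<lambda>x a _. g0 (m0 f x) = x + dif C a \<and> m1 f a = h (m0 f x)"])
    show "\<exists>a\<in>carr (C1 C). \<exists>_\<in>carr (C1 C). g0 (m0 f x) = x + dif C a \<and> m1 f a = h (m0 f x)"
      if x: "x \<in> carr (C0 C)" for x
    proof -
      obtain a where "a \<in> carr (C1 C)" "dif C a = g0 (m0 f x) - x" "m1 f a = h (m0 f x)"
        using lift[of "g0 (m0 f x) - x" "h (m0 f x)"] x by (auto simp: fg0)
      then show ?thesis by (intro bexI[of _ a]) simp_all
    qed
  qed (simp_all add: algebra_simps)
  note [simp] = linear_map_simps[OF g1(1) cod.C1_vspace] linear_map_simps[OF k(1) dom.C0_vspace]
  show thesis
  proof (rule that)
    show "chain_equiv C C' f \<lparr>m0 = g0, m1 = g1\<rparr> h k"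
    proof (intro chain_equiv.intro chain_equiv_axioms.intro C C' f h k(1))
      show "chain_map C' C \<lparr>m0 = g0, m1 = g1\<rparr>"
        using g0 g1 dg1 by (simp add: chain_map_def)
      \<comment> \<open>The homotopy relation in degree -1 was not part of any choice; it follows
        because both sides have the same differential and the same image under f.\<close>
      show "m1 \<lparr>m0 = g0, m1 = g1\<rparr> (m1 f a) = a + k (dif C a)" if "a \<in> carr (C1 C)" for a
        by (rule eq_by_f) (use that dg1 dk in simp_all)
    qed (simp_all add: fg0 dg1 dk)
  qed
qed

lemma quasi_iso_chain_equiv:
  fixes C :: "('k::field, 'o::ab_group_add, 'a::ab_group_add) cplx2"
    and C' :: "('k, 'p::ab_group_add, 'b::ab_group_add) cplx2"
  assumes C: "two_term_complex C" and C': "two_term_complex C'" and qi: "quasi_iso C C' f"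
  obtains g h k where "chain_equiv C C' f g h k"
proof -
  interpret dom: two_term_complex C by (rule C)
  interpret cod: two_term_complex C' by (rule C')
  have f: "chain_map C C' f" and H0: "bij_betw (H0_map C' f) (H0 C) (H0 C')"
    and H1: "bij_betw (m1 f) (Hm1 C) (Hm1 C')"
    using qi by (simp_all add: quasi_iso_def)
  note [simp] = linear_map_simps[OF chain_mapD(1)[OF f] dom.C0_vspace]
    linear_map_simps[OF chain_mapD(2)[OF f] dom.C1_vspace] chain_mapD(3)[OF f]
  have equiv: "equiv (carr (C0 D)) (cohom_rel D)" if D: "two_term_complex D"
    for D :: "('k, 'x::ab_group_add, 'y::ab_group_add) cplx2"
  proof -
    interpret D: two_term_complex D by (rule D)
    have refl: "x - x \<in> dif D ` carr (C1 D)" for x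
      by (rule image_eqI[of _ _ 0]) simp_all
    have sym: "y - x \<in> dif D ` carr (C1 D)" if xy: "x - y \<in> dif D ` carr (C1 D)" for x y
    proof -
      obtain a where "x - y = dif D a" "a \<in> carr (C1 D)" using xy by auto
      then show ?thesis by (intro image_eqI[of _ _ "- a"]) (simp_all add: algebra_simps)
    qed
    have trans: "x - z \<in> dif D ` carr (C1 D)"
      if xyz: "x - y \<in> dif D ` carr (C1 D)" "y - z \<in> dif D ` carr (C1 D)" for x y z
    proof -
      obtain a b where "x - y = dif D a" "a \<in> carr (C1 D)" "y - z = dif D b" "b \<in> carr (C1 D)"
        using xyz by auto
      then show ?thesis by (intro image_eqI[of _ _ "a + b"]) (simp_all add: algebra_simps)
    qed
    show ?thesis
    proof (rule equivI)
      show "refl_on (carr (C0 D)) (cohom_rel D)"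
        using refl by (simp add: refl_on_def cohom_rel_def del: diff_self)
      show "sym (cohom_rel D)"
        by (rule symI) (use sym in \<open>simp add: cohom_rel_def\<close>)
      show "trans (cohom_rel D)"
        by (rule transI) (use trans in \<open>force simp: cohom_rel_def\<close>)
    qed (auto simp: cohom_rel_def)
  qed
  note eqC = equiv[OF C] and eqC' = equiv[OF C']
  \<comment> \<open>\<open>H0_map\<close> takes a union over all representatives of a class. All of
    them yield the same class of C', so the induced map can be computed on one
    representative.\<close>
  have H0_map: "H0_map C' f (cohom_rel C `` {x}) = cohom_rel C' `` {m0 f x}" if x: "x \<in> carr (C0 C)" for x
  proof -
    have "cohom_rel C' `` {m0 f x'} = cohom_rel C' `` {m0 f x}" if "x' \<in> cohom_rel C `` {x}" for x'
    proof (rule equiv_class_eq[OF eqC'])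
      obtain a where a: "a \<in> carr (C1 C)" "x' \<in> carr (C0 C)" "x - x' = dif C a"
        using \<open>x' \<in> _\<close> by (auto simp: cohom_rel_def)
      then have "m0 f x' - m0 f x = dif C' (- m1 f a)"
        using x by (simp flip: a(3))
      then show "(m0 f x', m0 f x) \<in> cohom_rel C'"
        using a x by (auto simp: cohom_rel_def intro!: image_eqI[of _ _ "- m1 f a"])
    qed
    moreover have "x \<in> cohom_rel C `` {x}"
      using equiv_class_self[OF eqC x] .
    ultimately show ?thesis
      unfolding H0_map_def by blast
  qed
  show thesis
  proof (rule chain_equivI[OF C C' f _ _ _ that])
    show "a = 0" if "a \<in> carr (C1 C)" "dif C a = 0" "m1 f a = 0" for a
      using bij_betw_imp_inj_on[OF H1] that by (auto simp: inj_on_def Hm1_def)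
  next
    fix x b assume x: "x \<in> carr (C0 C)" and b: "b \<in> carr (C1 C')" and xb: "m0 f x = dif C' b"
    have "(m0 f x, m0 f 0) \<in> cohom_rel C'"
      using x b xb by (auto simp: cohom_rel_def)
    then have "H0_map C' f (cohom_rel C `` {x}) = H0_map C' f (cohom_rel C `` {0})"
      using x by (simp add: H0_map equiv_class_eq[OF eqC'])
    then have "cohom_rel C `` {x} = cohom_rel C `` {0}"
      using bij_betw_imp_inj_on[OF H0] x by (auto simp: inj_on_def H0_def quotientI)
    then have "(x, 0) \<in> cohom_rel C"
      using eq_equiv_class[OF _ eqC] by simp
    then obtain a where a: "a \<in> carr (C1 C)" "x = dif C a"
      by (auto simp: cohom_rel_def)
    \<comment> \<open>Injectivity on degree 0 cohomology made x a boundary d a, but f a need not be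
      b. The difference is a cocycle, hence the image of a cocycle c, and a - c is the lift.\<close>
    have "m1 f a - b \<in> Hm1 C'"
      using a b xb by (simp add: Hm1_def)
    then obtain c where "c \<in> carr (C1 C)" "dif C c = 0" "m1 f a - b = m1 f c"
      using bij_betw_imp_surj_on[OF H1] by (auto simp: Hm1_def)
    then show "\<exists>a\<in>carr (C1 C). dif C a = x \<and> m1 f a = b"
      using a by (intro bexI[of _ "a - c"]) (simp_all add: algebra_simps)
  next
    fix y assume y: "y \<in> carr (C0 C')"
    then have "cohom_rel C' `` {y} \<in> H0_map C' f ` H0 C"
      using bij_betw_imp_surj_on[OF H0] by (auto simp: H0_def quotientI)
    then obtain x where x: "x \<in> carr (C0 C)" "cohom_rel C' `` {y} = cohom_rel C' `` {m0 f x}"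
      by (auto simp: H0_def H0_map elim!: quotientE)
    then have "(m0 f x, y) \<in> cohom_rel C'"
      using eq_equiv_class[OF _ eqC' y] by simp
    then obtain b where b: "b \<in> carr (C1 C')" "m0 f x - y = dif C' b"
      by (auto simp: cohom_rel_def)
    then show "\<exists>x\<in>carr (C0 C). \<exists>b\<in>carr (C1 C'). m0 f x = y + dif C' b"
      using x(1) by (intro bexI[of _ x] bexI[of _ b]) (auto simp: algebra_simps)
  qed
qed

section \<open>Morphisms and transfer of 2-term \<open>EL\<^sub>\<infinity>\<close>-algebras\<close>

context el_algebra
begin

lemmas E_simps [simp] =
  bilinear_map_simps[OF br00_bilinear C0_vspace C0_vspace]
  bilinear_map_simps[OF br01_bilinear C0_vspace C1_vspace]
  bilinear_map_simps[OF br10_bilinear C1_vspace C0_vspace]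
  bilinear_map_simps[OF alt_bilinear C0_vspace C0_vspace]
  trilinear_map_simps[OF jac_trilinear C0_vspace C0_vspace C0_vspace]
  dif_br01 dif_br10 br_dif

text \<open>The simplifier moves the differential inside brackets, after which \<open>br_dif\<close>
  no longer matches. These are its instances for a bracketed element in that normal form.\<close>

lemma br_dif_br [simp]:
  assumes "x \<in> carr (C0 C)" "a \<in> carr (C1 C)" "b \<in> carr (C1 C)"
  shows "br01 E (br00 E x (dif C a)) b = br10 E (br01 E x a) (dif C b)"
    and "br01 E (br00 E (dif C a) x) b = br10 E (br10 E a x) (dif C b)"
  using assms br_dif[of "br01 E x a" b] br_dif[of "br10 E a x" b] by simp_all

text \<open>Rewriting with these rules leaves the differential only on atoms.\<close>

lemmas dif_elim =
  alt_00[symmetric] alt_10[symmetric] alt_01[symmetric]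
  jac_000[symmetric] jac_100[symmetric] jac_010[symmetric] jac_001[symmetric]

end

section \<open>Perturbing the identity of an algebra by a homotopy\<close>

locale el_homotopy = el_algebra C E
  for C :: "('k::field, 'o::ab_group_add, 'a::ab_group_add) cplx2" and E :: "('o, 'a) el_struct" +
  fixes k :: "'o \<Rightarrow> 'a"
  assumes k_linear: "linear_map (C0 C) (C1 C) k"
begin

lemmas k_simps [simp] = linear_map_simps[OF k_linear C0_vspace]

text \<open>This is the second component that 1 + d k must carry for k to be a 2-morphism from it to
  the identity: solve the equation of a 2-morphism and use [k x, k y] = [k x, d k y].\<close>

definition pert2 :: "'o \<Rightarrow> 'o \<Rightarrow> 'a" where
  "pert2 x y = br01 E x (k y) + br10 E (k x) y + br10 E (k x) (dif C (k y)) - k (br00 E x y)"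

text \<open>
  \<open>[x, p [y, z]] - [p [x, y], z] - [y, p [x, z]]\<close> with \<open>p = 1 + d k\<close> is the differential of
  the following; it becomes the Jacobiator of the transferred bracket.
\<close>

definition pert_jac :: "'o \<Rightarrow> 'o \<Rightarrow> 'o \<Rightarrow> 'a" where
  "pert_jac x y z = jac E x y z + br01 E x (k (br00 E y z))
     - br10 E (k (br00 E x y)) z - br01 E y (k (br00 E x z))"

lemma pert_jac_trilinear: "trilinear_map (C0 C) (C0 C) (C0 C) (C1 C) pert_jac"
  by (simp add: trilinear_map_def linear_map_def pert_jac_def algebra_simps)

lemmas pert_jac_simps = trilinear_map_simps[OF pert_jac_trilinear C0_vspace C0_vspace C0_vspace]

text \<open>\<open>p0\<close> and \<open>p1\<close> stand for the composite g f that appears between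
  nested transferred brackets. On expanding, every term containing k cancels and the Jacobiator
  identity of \<open>E\<close> remains. Applying f at arguments g x, g y, g z, g w gives the
  identity on C'.\<close>

lemma pert_coh_jac:
  assumes [simp]: "x \<in> carr (C0 C)" "y \<in> carr (C0 C)" "z \<in> carr (C0 C)" "w \<in> carr (C0 C)"
  defines "p0 \<equiv> \<lambda>x. x + dif C (k x)" and "p1 \<equiv> \<lambda>a. a + k (dif C a)"
  shows "br01 E x (p1 (pert_jac y z w)) + pert_jac x (p0 (br00 E y z)) w
      + pert_jac x z (p0 (br00 E y w)) + br10 E (p1 (pert_jac x y z)) w
      + br01 E z (p1 (pert_jac x y w))
    = pert_jac x y (p0 (br00 E z w)) + pert_jac (p0 (br00 E x y)) z w
      + br01 E y (p1 (pert_jac x z w)) + pert_jac y (p0 (br00 E x z)) w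
      + pert_jac y z (p0 (br00 E x w))" (is "?l = ?r")
proof -
  have "?l - ?r =
    (br01 E x (jac E y z w) + jac E x (br00 E y z) w + jac E x z (br00 E y w)
        + br10 E (jac E x y z) w + br01 E z (jac E x y w))
    - (jac E x y (br00 E z w) + jac E (br00 E x y) z w + br01 E y (jac E x z w)
        + jac E y (br00 E x z) w + jac E y z (br00 E x w))"
    by (simp add: p0_def p1_def pert_jac_def dif_elim algebra_simps)
  also have "\<dots> = 0"
    by (simp add: coh_jac)
  finally show ?thesis
    by simp
qed

end

section \<open>Composites of morphisms and inverses of 2-morphisms\<close>

context el_morphism
begin

lemmas F_simps [simp] =
  linear_map_simps[OF chain_mapD(1)[OF chain] dom.C0_vspace]
  linear_map_simps[OF chain_mapD(2)[OF chain] dom.C1_vspace]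
  chain_mapD(3)[OF chain]
  bilinear_map_simps[OF f2_bilinear dom.C0_vspace dom.C0_vspace]

text \<open>The morphism axioms solved for the terms to which f is applied. As rewrite rules they
  drive f down to atoms at the cost of terms in \<open>f2\<close>.\<close>

lemma m1_push:
  "a \<in> carr (C1 C) \<Longrightarrow> y \<in> carr (C0 C) \<Longrightarrow>
    m1 f (br10 E a y) = br10 E' (m1 f a) (m0 f y) - f2 (dif C a) y"
  "x \<in> carr (C0 C) \<Longrightarrow> b \<in> carr (C1 C) \<Longrightarrow>
    m1 f (br01 E x b) = br01 E' (m0 f x) (m1 f b) - f2 x (dif C b)"
  "x \<in> carr (C0 C) \<Longrightarrow> y \<in> carr (C0 C) \<Longrightarrow>
    m1 f (alt E x y) = alt E' (m0 f x) (m0 f y) - f2 x y - f2 y x"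
  "x \<in> carr (C0 C) \<Longrightarrow> y \<in> carr (C0 C) \<Longrightarrow> z \<in> carr (C0 C) \<Longrightarrow>
    m1 f (jac E x y z) = jac E' (m0 f x) (m0 f y) (m0 f z) - br01 E' (m0 f x) (f2 y z)
      + br01 E' (m0 f y) (f2 x z) + br10 E' (f2 x y) (m0 f z)
      + f2 (br00 E x y) z + f2 y (br00 E x z) - f2 x (br00 E y z)"
  using f2_10[of a y] f2_01[of x b] f2_alt[of x y] f2_jac[of x y z]
  by (simp_all add: algebra_simps)

lemmas push = f2_00[symmetric] m1_push

end

lemma el_morphism_comp:
  assumes "el_morphism C E C' E' f f2" and "el_morphism C' E' C'' E'' g g2"
  shows "el_morphism C E C'' E'' (comp_cmap g f) (el_comp2 g g2 f f2)"
proof -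
  interpret f: el_morphism C E C' E' f f2 by fact
  interpret g: el_morphism C' E' C'' E'' g g2 by fact
  show ?thesis
  proof unfold_locales
    show "chain_map C C'' (comp_cmap g f)"
      by (simp add: comp_cmap_def chain_map_def linear_map_def)
    show "bilinear_map (C0 C) (C0 C) (C1 C'') (el_comp2 g g2 f f2)"
      by (simp add: bilinear_map_def linear_map_def el_comp2_def algebra_simps)
  qed (simp_all add: comp_cmap_def el_comp2_def f.push g.push algebra_simps)
qed

text \<open>Replacing f by g = f - d \<theta> in the two linear brackets produces
  [\<theta> x, \<theta> y] twice, which reverses the sign of the quadratic term. Hence every
  2-morphism is invertible.\<close>

lemma el_2morphism_sym:
  assumes "el_morphism C E C' E' f f2" and "el_morphism C E C' E' g g2"
    and \<theta>: "el_2morphism C E C' E' f f2 g g2 \<theta>"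
  shows "el_2morphism C E C' E' g g2 f f2 (\<lambda>x. - \<theta> x)"
proof -
  interpret f: el_morphism C E C' E' f f2 by fact
  interpret g: el_morphism C E C' E' g g2 by fact
  have lin: "linear_map (C0 C) (C1 C') \<theta>"
    using \<theta> by (simp add: el_2morphism_def)
  note [simp] = linear_map_simps[OF lin f.dom.C0_vspace]
  have f0: "m0 f x = m0 g x + dif C' (\<theta> x)" if "x \<in> carr (C0 C)" for x
    using \<theta> that by (simp add: el_2morphism_def algebra_simps)
  have f1: "m1 f a = m1 g a + \<theta> (dif C a)" if "a \<in> carr (C1 C)" for a
    using \<theta> that by (simp add: el_2morphism_def algebra_simps)
  have f2: "f2 x y = g2 x y + br01 E' (m0 f x) (\<theta> y) + br10 E' (\<theta> x) (m0 f y) - \<theta> (br00 E x y)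
      - br11 C' E' (\<theta> x) (\<theta> y)" if "x \<in> carr (C0 C)" "y \<in> carr (C0 C)" for x y
    using \<theta> that by (simp add: el_2morphism_def algebra_simps)
  show ?thesis
    using lin by (simp add: el_2morphism_def f0 f1 f2 br11_def linear_map_def algebra_simps)
qed

lemma el_isomorphic_1morphismsI:
  assumes "el_morphism C E C' E' f f2" and "el_morphism C E C' E' g g2"
    and "el_2morphism C E C' E' f f2 g g2 \<theta>"
  shows "el_isomorphic_1morphisms C E C' E' f f2 g g2"
  unfolding el_isomorphic_1morphisms_def
  using assms(3) el_2morphism_sym[OF assms] by (intro exI[of _ \<theta>] exI[of _ "\<lambda>x. - \<theta> x"]) simp

lemma (in el_algebra) el_morphism_id: "el_morphism C E C E id_cmap el_id2"
  by unfold_locales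
    (simp_all add: id_cmap_def el_id2_def chain_map_def linear_map_def bilinear_map_def)

section \<open>Inverting a morphism over a homotopy equivalence\<close>

locale el_chain_equiv = el_morphism C E C' E' f f2 + chain_equiv C C' f g h k
  for C :: "('k::field, 'o::ab_group_add, 'a::ab_group_add) cplx2"
    and E :: "('o, 'a) el_struct"
    and C' :: "('k, 'p::ab_group_add, 'b::ab_group_add) cplx2"
    and E' :: "('p, 'b) el_struct" and f f2 g h k
begin

sublocale cod_h: el_homotopy C' E' h
  by unfold_locales (rule h_linear)

text \<open>
  By \<open>eq_by_f\<close>, an element of degree \<open>-1\<close> is determined by its differential and its image under
  \<open>f\<close>; \<open>g2\<close> is the unique solution of \<open>dif_g2\<close> and \<open>f1_g2\<close>, which say that \<open>g2\<close> and \<open>h\<close> have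
  the required boundaries.
\<close>

definition g2 :: "'p \<Rightarrow> 'p \<Rightarrow> 'a" where
  "g2 x y = m1 g (cod_h.pert2 x y - f2 (m0 g x) (m0 g y))
     - k (br00 E (m0 g x) (m0 g y) - m0 g (br00 E' x y))"

lemma g2_bilinear: "bilinear_map (C0 C') (C0 C') (C1 C) g2"
  by (simp add: bilinear_map_def linear_map_def g2_def cod_h.pert2_def algebra_simps)

lemmas g2_simps [simp] = bilinear_map_simps[OF g2_bilinear cod.C0_vspace cod.C0_vspace]

lemma dif_g2:
  "x \<in> carr (C0 C') \<Longrightarrow> y \<in> carr (C0 C') \<Longrightarrow>
    dif C (g2 x y) = br00 E (m0 g x) (m0 g y) - m0 g (br00 E' x y)"
  by (simp add: g2_def cod_h.pert2_def push algebra_simps)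

lemma f1_g2:
  "x \<in> carr (C0 C') \<Longrightarrow> y \<in> carr (C0 C') \<Longrightarrow>
    m1 f (g2 x y) = cod_h.pert2 x y - f2 (m0 g x) (m0 g y)"
  by (simp add: g2_def cod_h.pert2_def push algebra_simps)

text \<open>The equations in degree -1 are compared by \<open>eq_by_f\<close>. Under d they reduce
  to bracket identities by \<open>dif_g2\<close>. Under f, the terms in \<open>f2\<close> cancel by
  the axioms of (f, f2), which leaves the corresponding axiom of 1 + d h with second component
  \<open>pert2\<close>.\<close>

lemma g_morphism: "el_morphism C' E' C E g g2"
proof unfold_locales
  fix x y z a b
  show "chain_map C' C g" by (rule g_chain)
  show "bilinear_map (C0 C') (C0 C') (C1 C) g2" by (rule g2_bilinear)
  assume [simp]: "x \<in> carr (C0 C')" "y \<in> carr (C0 C')"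
  show "br00 E (m0 g x) (m0 g y) - m0 g (br00 E' x y) = dif C (g2 x y)"
    by (simp add: dif_g2)
  show "alt E (m0 g x) (m0 g y) - m1 g (alt E' x y) = g2 x y + g2 y x"
    by (rule eq_by_f)
      (simp_all add: dif_g2 f1_g2 push cod_h.pert2_def cod.dif_elim dom.dif_elim algebra_simps)
  show "z \<in> carr (C0 C') \<Longrightarrow> jac E (m0 g x) (m0 g y) (m0 g z) - m1 g (jac E' x y z)
    = br01 E (m0 g x) (g2 y z) - br01 E (m0 g y) (g2 x z) - br10 E (g2 x y) (m0 g z)
      - g2 (br00 E' x y) z - g2 y (br00 E' x z) + g2 x (br00 E' y z)"
    by (rule eq_by_f)
      (simp_all add: dif_g2 f1_g2 push cod_h.pert2_def cod.dif_elim dom.dif_elim algebra_simps)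
next
  fix x y a
  show "a \<in> carr (C1 C') \<Longrightarrow> y \<in> carr (C0 C') \<Longrightarrow>
    br10 E (m1 g a) (m0 g y) - m1 g (br10 E' a y) = g2 (dif C' a) y"
    by (rule eq_by_f)
      (simp_all add: dif_g2 f1_g2 push cod_h.pert2_def algebra_simps)
  show "x \<in> carr (C0 C') \<Longrightarrow> a \<in> carr (C1 C') \<Longrightarrow>
    br01 E (m0 g x) (m1 g a) - m1 g (br01 E' x a) = g2 x (dif C' a)"
    by (rule eq_by_f)
      (simp_all add: dif_g2 f1_g2 push cod_h.pert2_def algebra_simps)
qed

text \<open>The choice of \<open>g2\<close> was made with a view to f g. For g f the equation of a
  2-morphism is again tested under d and f, where coherence turns k into h.\<close>

lemma gf_2morphism: "el_2morphism C E C E (comp_cmap g f) (el_comp2 g g2 f f2) id_cmap el_id2 k"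
  unfolding el_2morphism_def
proof (intro conjI ballI)
  fix x y assume [simp]: "x \<in> carr (C0 C)" "y \<in> carr (C0 C)"
  show "el_comp2 g g2 f f2 x y - el_id2 x y =
    br01 E (m0 (comp_cmap g f) x) (k y) + br10 E (k x) (m0 (comp_cmap g f) y) - k (br00 E x y)
      - br11 C E (k x) (k y)"
    by (rule eq_by_f)
      (simp_all add: comp_cmap_def el_comp2_def el_id2_def br11_def dif_g2 f1_g2 push
        cod_h.pert2_def algebra_simps)
qed (simp_all add: k_linear comp_cmap_def id_cmap_def)

text \<open>By \<open>f1_g2\<close> the composite f g has second component \<open>pert2\<close>,
  which is exactly what makes h a 2-morphism to the identity.\<close>

lemma fg_2morphism: "el_2morphism C' E' C' E' (comp_cmap f g) (el_comp2 f f2 g g2) id_cmap el_id2 h"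
  by (simp add: el_2morphism_def h_linear comp_cmap_def id_cmap_def el_comp2_def el_id2_def
      br11_def f1_g2 cod_h.pert2_def algebra_simps)

lemma equivalence: "el_equivalence C E C' E' f f2"
  unfolding el_equivalence_def
proof (intro conjI exI)
  note f = el_morphism_axioms
  show "el_morphism C E C' E' f f2" by (rule f)
  show "el_morphism C' E' C E g g2" by (rule g_morphism)
  show "el_isomorphic_1morphisms C E C E (comp_cmap g f) (el_comp2 g g2 f f2) id_cmap el_id2"
    by (rule el_isomorphic_1morphismsI[OF el_morphism_comp[OF f g_morphism]
          dom.el_morphism_id gf_2morphism])
  show "el_isomorphic_1morphisms C' E' C' E' (comp_cmap f g) (el_comp2 f f2 g g2) id_cmap el_id2"
    by (rule el_isomorphic_1morphismsI[OF el_morphism_comp[OF g_morphism f]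
          cod.el_morphism_id fg_2morphism])
qed

end

text \<open>Invert the first morphism and compose with the second. The underlying chain map is f g,
  which is homotopic to the identity of C', so the composite is again a morphism over a coherent
  homotopy equivalence.\<close>

lemma el_equivalent_if_common_source:
  assumes fgh: "chain_equiv C C' f g h k"
    and "el_morphism C E C' E\<^sub>1 f f2" and f2': "el_morphism C E C' E\<^sub>2 f f2'"
  obtains p p2 h where "el_chain_equiv C' E\<^sub>1 C' E\<^sub>2 p p2 id_cmap h h"
proof -
  interpret E1: el_chain_equiv C E C' E\<^sub>1 f f2 g h k
    using assms by (simp add: el_chain_equiv_def)
  show thesis
    by (rule that, rule el_chain_equiv.intro)
      (rule el_morphism_comp[OF E1.g_morphism f2'] E1.chain_equiv_comp_id)+
qed

section \<open>Transferring a structure along a homotopy equivalence\<close>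

locale el_transfer = dom: el_algebra C E + chain_equiv C C' f g h k
  for C :: "('k::field, 'o::ab_group_add, 'a::ab_group_add) cplx2"
    and E :: "('o, 'a) el_struct"
    and C' :: "('k, 'p::ab_group_add, 'b::ab_group_add) cplx2"
    and f g h k
begin

sublocale dom_k: el_homotopy C E k
  by unfold_locales (rule k_linear)

text \<open>Opposite orientation to the simp rule: the image of a boundary under g must be displayed
  as d of an element of C before the axioms of \<open>E\<close> in \<open>dif_elim\<close> can
  absorb it.\<close>

lemmas g_dif = chain_mapD(3)[OF g_chain, symmetric]

definition transported :: "('p, 'b) el_struct" where
  "transported = \<lparr>br00 = \<lambda>x y. m0 f (br00 E (m0 g x) (m0 g y)),
    br01 = \<lambda>x b. m1 f (br01 E (m0 g x) (m1 g b)),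
    br10 = \<lambda>a y. m1 f (br10 E (m1 g a) (m0 g y)),
    alt = \<lambda>x y. m1 f (alt E (m0 g x) (m0 g y)),
    jac = \<lambda>x y z. m1 f (dom_k.pert_jac (m0 g x) (m0 g y) (m0 g z))\<rparr>"

text \<open>Expanding [g f x, g f y] - [x, y] with g f = 1 + d k exhibits it as the differential of
  the bracketed sum; f carries this to C'.\<close>

definition transported_f2 :: "'o \<Rightarrow> 'o \<Rightarrow> 'b" where
  "transported_f2 x y = m1 f (br01 E x (k y) + br10 E (k x) y + br10 E (k x) (dif C (k y)))"

text \<open>Each coherence identity is the image under f of an identity of \<open>E\<close> at the
  arguments g x, g y, g z. Where a transferred operation is nested, g f = 1 + d k intervenes, and
  the k-terms of \<open>pert_jac\<close> compensate for it; the Jacobiator identity is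
  \<open>pert_coh_jac\<close>.\<close>

lemma el_algebra_transported: "el_algebra C' transported"
proof unfold_locales
  fix x y z w
  assume [simp]: "x \<in> carr (C0 C')" "y \<in> carr (C0 C')" "z \<in> carr (C0 C')"
  show "jac transported x y z + jac transported y x z = - br10 transported (alt transported x y) z"
    using arg_cong[OF dom.coh_alt_left[of "m0 g x" "m0 g y" "m0 g z"], of "m1 f"]
    by (simp add: transported_def dom_k.pert_jac_def dom.dif_elim algebra_simps)
  show "jac transported x y z + jac transported x z y
    = br01 transported x (alt transported y z) - alt transported (br00 transported x y) z - alt transported y (br00 transported x z)"
    using arg_cong[OF dom.coh_alt_right[of "m0 g x" "m0 g y" "m0 g z"], of "m1 f"]
    by (simp add: transported_def dom_k.pert_jac_def dom.dif_elim algebra_simps)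
  show "alt transported x (br00 transported y z) = alt transported (br00 transported y z) x"
    using arg_cong[OF dom.coh_alt_sym[of "m0 g x" "m0 g y" "m0 g z"], of "m1 f"]
    by (simp add: transported_def dom.dif_elim algebra_simps)
  assume [simp]: "w \<in> carr (C0 C')"
  show "br01 transported x (jac transported y z w) + jac transported x (br00 transported y z) w + jac transported x z (br00 transported y w)
      + br10 transported (jac transported x y z) w + br01 transported z (jac transported x y w)
    = jac transported x y (br00 transported z w) + jac transported (br00 transported x y) z w + br01 transported y (jac transported x z w)
      + jac transported y (br00 transported x z) w + jac transported y z (br00 transported x w)"
    using arg_cong[OF dom_k.pert_coh_jac[of "m0 g x" "m0 g y" "m0 g z" "m0 g w"], of "m1 f"]
    by (simp add: transported_def dom_k.pert_jac_simps algebra_simps)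
qed (simp_all add: transported_def bilinear_map_def trilinear_map_def linear_map_def dom_k.pert_jac_def
      g_dif dom.dif_elim algebra_simps del: chain_mapD(3)[OF g_chain])

lemma el_morphism_transported: "el_morphism C E C' transported f transported_f2"
proof (intro el_morphism.intro el_morphism_axioms.intro el_algebra_transported f_chain dom.el_algebra_axioms)
qed (simp_all add: transported_def transported_f2_def bilinear_map_def linear_map_def dom_k.pert_jac_def dom.dif_elim algebra_simps)

end

lemma el_transfer_exists:
  assumes "el_algebra C E" and "two_term_complex C'" and "quasi_iso C C' f"
  shows "\<exists>E' f2. el_algebra C' E' \<and> el_equivalence C E C' E' f f2"
proof -
  interpret C: el_algebra C E by fact
  obtain g h k where "chain_equiv C C' f g h k"
    by (rule quasi_iso_chain_equiv[OF C.two_term_complex_axioms assms(2,3)])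
  then interpret tr: el_transfer C E C' f g h k
    by (intro el_transfer.intro C.el_algebra_axioms)
  interpret eq: el_chain_equiv C E C' tr.transported f tr.transported_f2 g h k
    by (intro el_chain_equiv.intro tr.el_morphism_transported tr.chain_equiv_axioms)
  show ?thesis
    using tr.el_algebra_transported eq.equivalence by blast
qed

lemma el_transfer_unique:
  assumes "quasi_iso C C' f" and f: "el_morphism C E C' E\<^sub>1 f f2" "el_morphism C E C' E\<^sub>2 f f2'"
  shows "el_equivalent C' E\<^sub>1 C' E\<^sub>2"
proof -
  interpret f: el_morphism C E C' E\<^sub>1 f f2 by fact
  obtain g h k where fgh: "chain_equiv C C' f g h k"
    by (rule quasi_iso_chain_equiv[OF f.dom.two_term_complex_axioms f.cod.two_term_complex_axioms assms(1)])
  obtain p p2 h where "el_chain_equiv C' E\<^sub>1 C' E\<^sub>2 p p2 id_cmap h h"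
    by (rule el_equivalent_if_common_source[OF fgh f])
  then show ?thesis
    unfolding el_equivalent_def using el_chain_equiv.equivalence by blast
qed

section \<open>Lie 2-algebras and their normalized complexes\<close>

definition ker_part :: "('k, 'o, 'a::ab_group_add) lincat \<Rightarrow> 'a \<Rightarrow> 'a" where
  "ker_part L f = f - idt L (src L f)"

definition nerve ::
  "('k, 'o::ab_group_add, 'a) lincat \<Rightarrow> ('k, 'o, 'a) cplx2" where
  "nerve L = \<lparr>C0 = Ob L,
     C1 = \<lparr>smul = smul (Ar L), carr = {a. a \<in> carr (Ar L) \<and> src L a = 0}\<rparr>,
     dif = tgt L\<rparr>"

lemma nerve_simps:
  "C0 (nerve L) = Ob L"
  "smul (C1 (nerve L)) = smul (Ar L)"
  "carr (C1 (nerve L)) = {a. a \<in> carr (Ar L) \<and> src L a = 0}"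
  "dif (nerve L) = tgt L"
  by (simp_all add: nerve_def)

lemmas unfold_nerve = nerve_simps mem_Collect_eq

context linear_category
begin

lemmas L_simps [simp] =
  is_vspace_simps[OF Ob_vspace] is_vspace_simps[OF Ar_vspace]
  linear_map_simps[OF src_linear Ar_vspace] linear_map_simps[OF tgt_linear Ar_vspace]
  linear_map_simps[OF idt_linear Ob_vspace]
  src_idt tgt_idt

text \<open>Composition is additive on composable pairs, and (g, f) is the sum of (g - 1, 0) and (1,
  f). Since 0 is the identity arrow of 0, the identity laws evaluate both summands.\<close>

lemma cmp_eq:
  assumes "g \<in> carr (Ar L)" "f \<in> carr (Ar L)" "src L g = tgt L f"
  shows "cmp L g f = g + f - idt L (src L g)"
proof -
  have a: "composable L (g - idt L (src L g)) 0"
    and f: "composable L (idt L (tgt L f)) f"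
    using assms by (simp_all add: composable_def)
  have "cmp L g f = cmp L (g - idt L (src L g)) 0 + cmp L (idt L (tgt L f)) f"
    using cmp_add[OF a f] assms by simp
  also have "cmp L (g - idt L (src L g)) 0 = g - idt L (src L g)"
    using cmp_idt_right[of "g - idt L (src L g)"] assms(1) by simp
  finally show ?thesis
    using assms by (simp add: cmp_idt_left)
qed

text \<open>Solving the formula for composition shows that every arrow has exactly one inverse, so
  the definite description in \<open>inv_arrow\<close> denotes it.\<close>

lemma inverse_arrows_iff:
  "inverse_arrows L f g \<longleftrightarrow>
     f \<in> carr (Ar L) \<and> g = idt L (src L f) + idt L (tgt L f) - f"
proof
  assume fg: "inverse_arrows L f g"
  then have *: "f \<in> carr (Ar L)" "g \<in> carr (Ar L)" "src L g = tgt L f"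
    by (simp_all add: inverse_arrows_def composable_def)
  then have "g + f - idt L (tgt L f) = idt L (src L f)"
    using fg by (simp add: inverse_arrows_def cmp_eq)
  with * show "f \<in> carr (Ar L) \<and> g = idt L (src L f) + idt L (tgt L f) - f"
    by (simp add: algebra_simps)
qed (simp add: inverse_arrows_def composable_def cmp_eq)

lemma inv_arrow_eq:
  "f \<in> carr (Ar L) \<Longrightarrow> inv_arrow L f = idt L (src L f) + idt L (tgt L f) - f"
  by (simp add: inv_arrow_def inverse_arrows_iff)

lemma ker_part_linear: "linear_map (Ar L) (Ar L) (ker_part L)"
  by (simp add: linear_map_def ker_part_def algebra_simps)

lemmas ker_part_simps [simp] = linear_map_simps[OF ker_part_linear Ar_vspace]

lemma ker_part [simp]:
  "f \<in> carr (Ar L) \<Longrightarrow> src L (ker_part L f) = 0"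
  "f \<in> carr (Ar L) \<Longrightarrow> tgt L (ker_part L f) = tgt L f - src L f"
  "x \<in> carr (Ob L) \<Longrightarrow> ker_part L (idt L x) = 0"
  "src L f = 0 \<Longrightarrow> ker_part L f = f"
  by (simp_all add: ker_part_def)

lemma arrow_cases:
  assumes "f \<in> carr (Ar L)"
  obtains x a where "x \<in> carr (Ob L)" "a \<in> carr (Ar L)" "src L a = 0" "f = idt L x + a"
  by (rule that[of "src L f" "ker_part L f"]) (use assms in \<open>simp_all add: ker_part_def\<close>)

lemma nerve_complex: "two_term_complex (nerve L)"
proof
  show "is_vspace (C0 (nerve L))"
    by (simp add: nerve_simps Ob_vspace)
  interpret vector_space "smul (Ar L)"
    using Ar_vspace by (simp add: is_vspace_def)
  have "subspace (carr (C1 (nerve L)))"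
    by (rule subspaceI) (simp_all add: nerve_simps)
  then show "is_vspace (C1 (nerve L))"
    by (simp add: is_vspace_def nerve_simps vector_space_axioms)
  show "linear_map (C1 (nerve L)) (C0 (nerve L)) (dif (nerve L))"
    by (simp add: nerve_simps linear_map_def)
qed

end

section \<open>From structures on the normalized complex to Lie 2-algebras\<close>

text \<open>
  The arrow \<open>f\<close> is split as \<open>idt (src f) + ker_part f\<close>, and \<open>[a, b]\<close> for \<open>a, b\<close> in the
  kernel of \<open>src\<close> is absorbed into the second summand by means of \<open>tgt f\<close>.
\<close>

locale lie2_el = linear_category L + el: el_algebra "nerve L" E
  for L :: "('k::field, 'o::ab_group_add, 'a::ab_group_add) lincat"
    and B :: "('o, 'a) lie2_struct" and E :: "('o, 'a) el_struct" +
  assumes lbo_eq: "x \<in> carr (Ob L) \<Longrightarrow> y \<in> carr (Ob L) \<Longrightarrow> lbo B x y = br00 E x y"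
    and lba_eq: "f \<in> carr (Ar L) \<Longrightarrow> g \<in> carr (Ar L) \<Longrightarrow>
      lba B f g = idt L (br00 E (src L f) (src L g)) + br10 E (ker_part L f) (src L g)
        + br01 E (tgt L f) (ker_part L g)"
    and altr_eq: "x \<in> carr (Ob L) \<Longrightarrow> y \<in> carr (Ob L) \<Longrightarrow>
      altr B x y = idt L (br00 E x y) - alt E x y"
    and jctr_eq: "x \<in> carr (Ob L) \<Longrightarrow> y \<in> carr (Ob L) \<Longrightarrow> z \<in> carr (Ob L) \<Longrightarrow>
      jctr B x y z = idt L (br00 E x (br00 E y z)) - jac E x y z"
begin

lemmas EL_simps [simp] = el.E_simps[unfolded unfold_nerve] el.br_dif_br[unfolded unfold_nerve]
lemmas EL_dif_elim = el.dif_elim[unfolded unfold_nerve]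
lemmas EL_coh = el.coh_jac[unfolded unfold_nerve] el.coh_alt_left[unfolded unfold_nerve]
  el.coh_alt_right[unfolded unfold_nerve] el.coh_alt_sym[unfolded unfold_nerve]
lemmas B_eq = lbo_eq lba_eq altr_eq jctr_eq

text \<open>With arrows split by \<open>arrow_cases\<close> and composites expanded by
  \<open>cmp_eq\<close>, functoriality and naturality become the mixed-degree axioms of
  \<open>E\<close>, and \<open>L1\<close> to \<open>L4\<close> become its four coherence
  identities.\<close>

lemma lie_2_algebra: "lie_2_algebra L B"
proof (intro lie_2_algebra.intro lie_2_algebra_axioms.intro linear_category_axioms)
  show "bilinear_map (Ob L) (Ob L) (Ob L) (lbo B)"
    by (simp add: bilinear_map_def linear_map_def B_eq)
  show "bilinear_map (Ob L) (Ob L) (Ar L) (altr B)"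
    by (simp add: bilinear_map_def linear_map_def B_eq)
  show "trilinear_map (Ob L) (Ob L) (Ob L) (Ar L) (jctr B)"
    by (simp add: trilinear_map_def linear_map_def B_eq)
  show "bilinear_map (Ar L) (Ar L) (Ar L) (lba B)"
    by (simp add: bilinear_map_def linear_map_def B_eq algebra_simps)
next
  fix f g assume fg: "f \<in> carr (Ar L)" "g \<in> carr (Ar L)"
  obtain x a where [simp]: "x \<in> carr (Ob L)" "a \<in> carr (Ar L)" "src L a = 0" "f = idt L x + a"
    by (rule arrow_cases[OF fg(1)])
  obtain y b where [simp]: "y \<in> carr (Ob L)" "b \<in> carr (Ar L)" "src L b = 0" "g = idt L y + b"
    by (rule arrow_cases[OF fg(2)])
  show "src L (lba B f g) = lbo B (src L f) (src L g)"
    by (simp add: lba_eq lbo_eq)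
  show "tgt L (lba B f g) = lbo B (tgt L f) (tgt L g)"
    by (simp add: lba_eq lbo_eq)
  show "cmp L (altr B (tgt L f) (tgt L g)) (lba B f g)
    = cmp L (- lba B g f) (altr B (src L f) (src L g))"
    by (simp add: lba_eq lbo_eq altr_eq cmp_eq EL_dif_elim algebra_simps)
next
  fix f g h assume fgh: "f \<in> carr (Ar L)" "g \<in> carr (Ar L)" "h \<in> carr (Ar L)"
  obtain x a where [simp]: "x \<in> carr (Ob L)" "a \<in> carr (Ar L)" "src L a = 0" "f = idt L x + a"
    by (rule arrow_cases[OF fgh(1)])
  obtain y b where [simp]: "y \<in> carr (Ob L)" "b \<in> carr (Ar L)" "src L b = 0" "g = idt L y + b"
    by (rule arrow_cases[OF fgh(2)])
  obtain z c where [simp]: "z \<in> carr (Ob L)" "c \<in> carr (Ar L)" "src L c = 0" "h = idt L z + c"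
    by (rule arrow_cases[OF fgh(3)])
  show "cmp L (jctr B (tgt L f) (tgt L g) (tgt L h)) (lba B f (lba B g h))
      = cmp L (lba B (lba B f g) h + lba B g (lba B f h))
              (jctr B (src L f) (src L g) (src L h))"
    by (simp add: lba_eq lbo_eq jctr_eq cmp_eq EL_dif_elim algebra_simps)
next
  fix f' f g' g assume comp: "composable L f' f" "composable L g' g"
  then have ar: "f \<in> carr (Ar L)" "f' \<in> carr (Ar L)" "g \<in> carr (Ar L)" "g' \<in> carr (Ar L)"
    by (simp_all add: composable_def)
  obtain x a where [simp]: "x \<in> carr (Ob L)" "a \<in> carr (Ar L)" "src L a = 0" "f = idt L x + a"
    by (rule arrow_cases[OF ar(1)])
  obtain x' a' where x': "x' \<in> carr (Ob L)" and [simp]: "a' \<in> carr (Ar L)" "src L a' = 0" "f' = idt L x' + a'"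
    by (rule arrow_cases[OF ar(2)])
  obtain y b where [simp]: "y \<in> carr (Ob L)" "b \<in> carr (Ar L)" "src L b = 0" "g = idt L y + b"
    by (rule arrow_cases[OF ar(3)])
  obtain y' b' where y': "y' \<in> carr (Ob L)" and [simp]: "b' \<in> carr (Ar L)" "src L b' = 0" "g' = idt L y' + b'"
    by (rule arrow_cases[OF ar(4)])
  \<comment> \<open>Composability forces the sources of \<open>f'\<close> and \<open>g'\<close>, so
    x, y and four kernel elements are the only free data.\<close>
  have [simp]: "x' = x + tgt L a" "y' = y + tgt L b"
    using comp x' y' by (simp_all add: composable_def)
  show "lba B (cmp L f' f) (cmp L g' g) = cmp L (lba B f' g') (lba B f g)"
    by (simp add: lba_eq cmp_eq algebra_simps)
next
  fix x y assume [simp]: "x \<in> carr (Ob L)" "y \<in> carr (Ob L)"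
  show "lba B (idt L x) (idt L y) = idt L (lbo B x y)"
    by (simp add: B_eq)
  show "arrow_in L (altr B x y) (lbo B x y) (- lbo B y x)"
    by (simp add: B_eq arrow_in_def EL_dif_elim)
  fix z assume [simp]: "z \<in> carr (Ob L)"
  show "arrow_in L (jctr B x y z) (lbo B x (lbo B y z)) (lbo B (lbo B x y) z + lbo B y (lbo B x z))"
    by (simp add: B_eq arrow_in_def EL_dif_elim)
  \<comment> \<open>The left alternator identity in the shape, one sum equal to zero, that is
    matched against \<open>L2\<close> after inverses and composites are expanded.\<close>
  have "jac E x y z + (jac E y x z + br10 E (alt E x y) z) = 0"
    using EL_coh(2)[of x y z] by (simp flip: add.assoc)
  then show "cmp L (- jctr_hat L B y x z) (lba B (altr B x y) (idt L z)) = jctr_hat L B x y z"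
    by (simp add: B_eq jctr_hat_def inv_arrow_eq cmp_eq EL_dif_elim algebra_simps)
  show "cmp L (- jctr B x z y) (lba B (idt L x) (altr B y z))
      = cmp L (altr B (lbo B x y) z + altr B y (lbo B x z)) (jctr B x y z)"
    using EL_coh(3)[of x y z]
    by (simp add: B_eq cmp_eq EL_dif_elim algebra_simps)
  show "cmp L (- altr B (lbo B y z) x) (altr B x (lbo B y z)) = idt L (lbo B x (lbo B y z))"
    using EL_coh(4)[of x y z]
    by (simp add: B_eq cmp_eq EL_dif_elim algebra_simps)
  fix w assume [simp]: "w \<in> carr (Ob L)"
  show "cmp L
        (cmp L
          (lba B (jctr B x y z) (idt L w)
            + idt L (lbo B (lbo B y z) (lbo B x w))
            + idt L (lbo B (lbo B x z) (lbo B y w))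
            + lba B (idt L z) (jctr B x y w))
          (jctr B x (lbo B y z) w + jctr B x z (lbo B y w)))
        (lba B (idt L x) (jctr B y z w))
      = cmp L
        (cmp L
          (idt L (lbo B (lbo B (lbo B x y) z) w)
            + idt L (lbo B z (lbo B (lbo B x y) w))
            + jctr B y (lbo B x z) w
            + jctr B y z (lbo B x w))
          (jctr B (lbo B x y) z w + lba B (idt L y) (jctr B x z w)))
        (jctr B x y (lbo B z w))"
    using EL_coh(1)[of x y z w]
    by (simp add: B_eq cmp_eq EL_dif_elim algebra_simps)
qed

end

section \<open>From Lie 2-algebras to structures on the normalized complex\<close>

definition el_of_lie2 ::
  "('k, 'o, 'a::ab_group_add) lincat \<Rightarrow> ('o, 'a) lie2_struct \<Rightarrow> ('o, 'a) el_struct" where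
  "el_of_lie2 L B = \<lparr>br00 = lbo B,
     br01 = \<lambda>x b. lba B (idt L x) b,
     br10 = \<lambda>a y. lba B a (idt L y),
     alt = \<lambda>x y. idt L (lbo B x y) - altr B x y,
     jac = \<lambda>x y z. idt L (lbo B x (lbo B y z)) - jctr B x y z\<rparr>"

definition lie2_of_el ::
  "('k, 'o, 'a::ab_group_add) lincat \<Rightarrow> ('o, 'a) el_struct \<Rightarrow> ('o, 'a) lie2_struct" where
  "lie2_of_el L E = \<lparr>lbo = br00 E,
     lba = \<lambda>f g. idt L (br00 E (src L f) (src L g)) + br10 E (ker_part L f) (src L g)
        + br01 E (tgt L f) (ker_part L g),
     altr = \<lambda>x y. idt L (br00 E x y) - alt E x y,
     jctr = \<lambda>x y z. idt L (br00 E x (br00 E y z)) - jac E x y z\<rparr>"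

lemma lie2_of_el:
  assumes "linear_category L" and "el_algebra (nerve L) E"
  shows "lie2_el L (lie2_of_el L E) E"
  using assms by (simp add: lie2_el_def lie2_el_axioms_def lie2_of_el_def)

context lie_2_algebra
begin

lemmas B_simps [simp] =
  bilinear_map_simps[OF bracket_ob Ob_vspace Ob_vspace]
  bilinear_map_simps[OF bracket_ar Ar_vspace Ar_vspace]
  bilinear_map_simps[OF S_bilinear Ob_vspace Ob_vspace]
  trilinear_map_simps[OF J_trilinear Ob_vspace Ob_vspace Ob_vspace]
  bracket_src bracket_tgt bracket_idt

lemma S_src_tgt [simp]:
  "x \<in> carr (Ob L) \<Longrightarrow> y \<in> carr (Ob L) \<Longrightarrow> src L (altr B x y) = lbo B x y"
  "x \<in> carr (Ob L) \<Longrightarrow> y \<in> carr (Ob L) \<Longrightarrow> tgt L (altr B x y) = - lbo B y x"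
  using S_arrow by (simp_all add: arrow_in_def)

lemma J_src_tgt [simp]:
  "x \<in> carr (Ob L) \<Longrightarrow> y \<in> carr (Ob L) \<Longrightarrow> z \<in> carr (Ob L) \<Longrightarrow>
    src L (jctr B x y z) = lbo B x (lbo B y z)"
  "x \<in> carr (Ob L) \<Longrightarrow> y \<in> carr (Ob L) \<Longrightarrow> z \<in> carr (Ob L) \<Longrightarrow>
    tgt L (jctr B x y z) = lbo B (lbo B x y) z + lbo B y (lbo B x z)"
  using J_arrow by (simp_all add: arrow_in_def)

text \<open>The pair (f, g) can be composed from a change of f followed by a change of g, or in the
  other order; \<open>bracket_cmp\<close> expands the bracket along both. For kernel elements a, b
  the two expansions read [d a, b] and [a, d b].\<close>

lemma lba_interchange:
  assumes "f \<in> carr (Ar L)" "g \<in> carr (Ar L)"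
  shows "lba B f g = lba B (idt L (tgt L f)) g + lba B f (idt L (src L g))
      - idt L (lbo B (tgt L f) (src L g))"
    and "lba B f g = lba B f (idt L (tgt L g)) + lba B (idt L (src L f)) g
      - idt L (lbo B (src L f) (tgt L g))"
  using assms bracket_cmp[of "idt L (tgt L f)" f g "idt L (src L g)"]
    bracket_cmp[of f "idt L (src L f)" "idt L (tgt L g)" g]
  by (simp_all add: composable_def cmp_eq)

text \<open>Naturality of \<open>S\<close> and \<open>J\<close> at one kernel arrow, with identities
  in the other slots, yields the mixed-degree axioms. \<open>br_dif\<close> compares the two
  expansions of \<open>lba_interchange\<close>, and \<open>L1\<close> to \<open>L4\<close> yield the
  coherence identities.\<close>

lemma el_of_lie2: "el_algebra (nerve L) (el_of_lie2 L B)"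
proof (intro el_algebra.intro nerve_complex el_algebra_axioms.intro; unfold unfold_nerve)
  fix x y b assume "x \<in> carr (Ob L)" "b \<in> carr (Ar L) \<and> src L b = 0"
  then show "br01 (el_of_lie2 L B) x b + br10 (el_of_lie2 L B) b x = alt (el_of_lie2 L B) x (tgt L b)"
    using S_natural[of "idt L x" b] by (simp add: el_of_lie2_def cmp_eq algebra_simps)
next
  fix a y assume "a \<in> carr (Ar L) \<and> src L a = 0" "y \<in> carr (Ob L)"
  then show "br10 (el_of_lie2 L B) a y + br01 (el_of_lie2 L B) y a = alt (el_of_lie2 L B) (tgt L a) y"
    using S_natural[of a "idt L y"] by (simp add: el_of_lie2_def cmp_eq algebra_simps)
next
  fix a b assume "a \<in> carr (Ar L) \<and> src L a = 0" "b \<in> carr (Ar L) \<and> src L b = 0"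
  then show "br01 (el_of_lie2 L B) (tgt L a) b = br10 (el_of_lie2 L B) a (tgt L b)"
    using lba_interchange[of a b] by (simp add: el_of_lie2_def)
next
  fix a y z assume "a \<in> carr (Ar L) \<and> src L a = 0" "y \<in> carr (Ob L)" "z \<in> carr (Ob L)"
  then show "br10 (el_of_lie2 L B) a (br00 (el_of_lie2 L B) y z)
      - br10 (el_of_lie2 L B) (br10 (el_of_lie2 L B) a y) z
      - br01 (el_of_lie2 L B) y (br10 (el_of_lie2 L B) a z) = jac (el_of_lie2 L B) (tgt L a) y z"
    using J_natural[of a "idt L y" "idt L z"]
    by (simp add: el_of_lie2_def cmp_eq algebra_simps)
next
  fix x b z assume "x \<in> carr (Ob L)" "b \<in> carr (Ar L) \<and> src L b = 0" "z \<in> carr (Ob L)"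
  then show "br01 (el_of_lie2 L B) x (br10 (el_of_lie2 L B) b z)
      - br10 (el_of_lie2 L B) (br01 (el_of_lie2 L B) x b) z
      - br10 (el_of_lie2 L B) b (br00 (el_of_lie2 L B) x z) = jac (el_of_lie2 L B) x (tgt L b) z"
    using J_natural[of "idt L x" b "idt L z"]
    by (simp add: el_of_lie2_def cmp_eq algebra_simps)
next
  fix x y c assume "x \<in> carr (Ob L)" "y \<in> carr (Ob L)" "c \<in> carr (Ar L) \<and> src L c = 0"
  then show "br01 (el_of_lie2 L B) x (br01 (el_of_lie2 L B) y c)
      - br01 (el_of_lie2 L B) (br00 (el_of_lie2 L B) x y) c
      - br01 (el_of_lie2 L B) y (br01 (el_of_lie2 L B) x c) = jac (el_of_lie2 L B) x y (tgt L c)"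
    using J_natural[of "idt L x" "idt L y" c]
    by (simp add: el_of_lie2_def cmp_eq algebra_simps)
next
  fix x y z assume [simp]: "x \<in> carr (Ob L)" "y \<in> carr (Ob L)" "z \<in> carr (Ob L)"
  show "jac (el_of_lie2 L B) x y z + jac (el_of_lie2 L B) y x z
      = - br10 (el_of_lie2 L B) (alt (el_of_lie2 L B) x y) z"
    using L2[of x y z]
    by (simp add: el_of_lie2_def cmp_eq jctr_hat_def inv_arrow_eq algebra_simps)
  show "jac (el_of_lie2 L B) x y z + jac (el_of_lie2 L B) x z y
      = br01 (el_of_lie2 L B) x (alt (el_of_lie2 L B) y z)
        - alt (el_of_lie2 L B) (br00 (el_of_lie2 L B) x y) z
        - alt (el_of_lie2 L B) y (br00 (el_of_lie2 L B) x z)"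
    using L3[of x y z] by (simp add: el_of_lie2_def cmp_eq algebra_simps)
  show "alt (el_of_lie2 L B) x (br00 (el_of_lie2 L B) y z)
      = alt (el_of_lie2 L B) (br00 (el_of_lie2 L B) y z) x"
    using L4[of x y z] by (simp add: el_of_lie2_def cmp_eq algebra_simps)
  fix w assume [simp]: "w \<in> carr (Ob L)"
  show "br01 (el_of_lie2 L B) x (jac (el_of_lie2 L B) y z w)
      + jac (el_of_lie2 L B) x (br00 (el_of_lie2 L B) y z) w
      + jac (el_of_lie2 L B) x z (br00 (el_of_lie2 L B) y w)
      + br10 (el_of_lie2 L B) (jac (el_of_lie2 L B) x y z) w
      + br01 (el_of_lie2 L B) z (jac (el_of_lie2 L B) x y w)
    = jac (el_of_lie2 L B) x y (br00 (el_of_lie2 L B) z w)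
      + jac (el_of_lie2 L B) (br00 (el_of_lie2 L B) x y) z w
      + br01 (el_of_lie2 L B) y (jac (el_of_lie2 L B) x z w)
      + jac (el_of_lie2 L B) y (br00 (el_of_lie2 L B) x z) w
      + jac (el_of_lie2 L B) y z (br00 (el_of_lie2 L B) x w)"
    using L1[of x y z w] by (simp add: el_of_lie2_def cmp_eq algebra_simps)
qed (simp_all add: el_of_lie2_def bilinear_map_def trilinear_map_def linear_map_def unfold_nerve
      algebra_simps)

lemma lie2_el_of_lie2: "lie2_el L B (el_of_lie2 L B)"
proof (intro lie2_el.intro linear_category_axioms el_of_lie2 lie2_el_axioms.intro)
  fix f g assume fg: "f \<in> carr (Ar L)" "g \<in> carr (Ar L)"
  show "lba B f g = idt L (br00 (el_of_lie2 L B) (src L f) (src L g))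
      + br10 (el_of_lie2 L B) (ker_part L f) (src L g)
      + br01 (el_of_lie2 L B) (tgt L f) (ker_part L g)"
    using fg by (subst lba_interchange(1)) (simp_all add: el_of_lie2_def ker_part_def)
qed (simp_all add: el_of_lie2_def)

end

section \<open>Linear functors and chain maps\<close>

definition ftor_of_cmap ::
  "('k, 'o::ab_group_add, 'a::ab_group_add) lincat \<Rightarrow> ('k, 'p, 'b::ab_group_add) lincat \<Rightarrow>
   ('o, 'a, 'p, 'b) cmap \<Rightarrow> ('o, 'a, 'p, 'b) ftor" where
  "ftor_of_cmap L L' f = \<lparr>fob = m0 f, far = \<lambda>u. idt L' (m0 f (src L u)) + m1 f (ker_part L u)\<rparr>"

text \<open>The arrow map is taken whole; as a component of degree -1 it matters only on the kernel
  of the source.\<close>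

definition cmap_of_ftor :: "('o, 'a, 'p, 'b) ftor \<Rightarrow> ('o, 'a, 'p, 'b) cmap" where
  "cmap_of_ftor F = \<lparr>m0 = fob F, m1 = far F\<rparr>"

text \<open>A relation on carriers rather than an equality of functions, so that functors built from
  chain maps, chain maps read off from functors, identities and composites are all
  instances.\<close>

locale ftor_cmap = dom: linear_category L + cod: linear_category L'
  for L :: "('k::field, 'o::ab_group_add, 'a::ab_group_add) lincat"
    and L' :: "('k, 'p::ab_group_add, 'b::ab_group_add) lincat" +
  fixes F :: "('o, 'a, 'p, 'b) ftor" and f :: "('o, 'a, 'p, 'b) cmap"
  assumes nerve_chain: "chain_map (nerve L) (nerve L') f"
    and fob_eq: "x \<in> carr (Ob L) \<Longrightarrow> fob F x = m0 f x"
    and far_eq: "u \<in> carr (Ar L) \<Longrightarrow> far F u = idt L' (m0 f (src L u)) + m1 f (ker_part L u)"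
begin

lemmas f_simps [simp] =
  linear_map_simps[OF chain_mapD(1)[OF nerve_chain] two_term_complex.C0_vspace[OF dom.nerve_complex],
    unfolded unfold_nerve]
  linear_map_simps[OF chain_mapD(2)[OF nerve_chain] two_term_complex.C1_vspace[OF dom.nerve_complex],
    unfolded unfold_nerve]
  chain_mapD(3)[OF nerve_chain, unfolded unfold_nerve]

lemma linear_functor: "linear_functor L L' F"
  by (auto simp: linear_functor_def linear_map_def fob_eq far_eq composable_def dom.cmp_eq cod.cmp_eq
      algebra_simps)

end

lemma ftor_of_cmap:
  assumes "linear_category L" "linear_category L'" "chain_map (nerve L) (nerve L') f"
  shows "ftor_cmap L L' (ftor_of_cmap L L' f) f"
  using assms by (simp add: ftor_cmap_def ftor_cmap_axioms_def ftor_of_cmap_def)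

lemma linear_functorD:
  assumes "linear_functor L L' F"
  shows "linear_map (Ob L) (Ob L') (fob F)" "linear_map (Ar L) (Ar L') (far F)"
    and "u \<in> carr (Ar L) \<Longrightarrow> src L' (far F u) = fob F (src L u)"
    and "u \<in> carr (Ar L) \<Longrightarrow> tgt L' (far F u) = fob F (tgt L u)"
    and "x \<in> carr (Ob L) \<Longrightarrow> far F (idt L x) = idt L' (fob F x)"
  using assms by (simp_all add: linear_functor_def)

lemma cmap_of_ftor:
  assumes "linear_category L" "linear_category L'" and F: "linear_functor L L' F"
  shows "ftor_cmap L L' F (cmap_of_ftor F)"
proof -
  interpret dom: linear_category L by fact
  interpret cod: linear_category L' by fact
  note [simp] = linear_map_simps[OF linear_functorD(1)[OF F] dom.Ob_vspace]
    linear_map_simps[OF linear_functorD(2)[OF F] dom.Ar_vspace] linear_functorD(3-5)[OF F]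
  show ?thesis
    by unfold_locales
      (simp_all add: cmap_of_ftor_def chain_map_def linear_map_def unfold_nerve ker_part_def)
qed

section \<open>Morphisms of Lie 2-algebras and of their normalized complexes\<close>

locale lie2_el_morphism =
  dom: lie2_el L B E + cod: lie2_el L' B' E' + ftor_cmap L L' F f
    + el: el_morphism "nerve L" E "nerve L'" E' f f2
  for L :: "('k::field, 'o::ab_group_add, 'a::ab_group_add) lincat"
    and B :: "('o, 'a) lie2_struct" and E :: "('o, 'a) el_struct"
    and L' :: "('k, 'p::ab_group_add, 'b::ab_group_add) lincat"
    and B' :: "('p, 'b) lie2_struct" and E' :: "('p, 'b) el_struct"
    and F f f2 +
  fixes F2 :: "'o \<Rightarrow> 'o \<Rightarrow> 'b"
  assumes F2_eq: "x \<in> carr (Ob L) \<Longrightarrow> y \<in> carr (Ob L) \<Longrightarrow>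
    F2 x y = idt L' (br00 E' (m0 f x) (m0 f y)) - f2 x y"
begin

lemmas f2_simps [simp] = bilinear_map_simps[OF el.f2_bilinear dom.el.C0_vspace dom.el.C0_vspace,
  unfolded unfold_nerve]
lemmas f_push = el.push[unfolded unfold_nerve]

lemma lie2_morphism: "lie2_morphism L B L' B' F F2"
proof (intro lie2_morphism.intro lie2_morphism_axioms.intro dom.lie_2_algebra cod.lie_2_algebra
    linear_functor)
  show "bilinear_map (Ob L) (Ob L) (Ar L') F2"
    by (simp add: bilinear_map_def linear_map_def F2_eq algebra_simps)
next
  fix u v assume uv: "u \<in> carr (Ar L)" "v \<in> carr (Ar L)"
  obtain x a where [simp]: "x \<in> carr (Ob L)" "a \<in> carr (Ar L)" "src L a = 0" "u = idt L x + a"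
    by (rule dom.arrow_cases[OF uv(1)])
  obtain y b where [simp]: "y \<in> carr (Ob L)" "b \<in> carr (Ar L)" "src L b = 0" "v = idt L y + b"
    by (rule dom.arrow_cases[OF uv(2)])
  \<comment> \<open>The differential of \<open>m1 f a\<close> is rewritten to
    \<open>m0 f (tgt L a)\<close>, which hides the instance of \<open>br_dif\<close> for
    \<open>E'\<close>; it is supplied in the rewritten form.\<close>
  have "br01 E' (m0 f (tgt L a)) (m1 f b) = br10 E' (m1 f a) (m0 f (tgt L b))"
    using cod.el.br_dif[of "m1 f a" "m1 f b", unfolded unfold_nerve] by simp
  then show "cmp L' (F2 (tgt L u) (tgt L v)) (lba B' (far F u) (far F v))
      = cmp L' (far F (lba B u v)) (F2 (src L u) (src L v))"
    by (simp add: far_eq F2_eq dom.B_eq cod.B_eq cod.cmp_eq f_push algebra_simps)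
next
  fix x y assume [simp]: "x \<in> carr (Ob L)" "y \<in> carr (Ob L)"
  show "arrow_in L' (F2 x y) (lbo B' (fob F x) (fob F y)) (fob F (lbo B x y))"
    by (simp add: fob_eq F2_eq dom.B_eq cod.B_eq arrow_in_def f_push)
  show "cmp L' (far F (altr B x y)) (F2 x y) = cmp L' (- F2 y x) (altr B' (fob F x) (fob F y))"
    by (simp add: fob_eq far_eq F2_eq dom.B_eq cod.B_eq cod.cmp_eq f_push
        dom.EL_dif_elim cod.EL_dif_elim algebra_simps)
  fix z assume [simp]: "z \<in> carr (Ob L)"
  show "cmp L' (cmp L' (far F (jctr B x y z)) (F2 x (lbo B y z)))
             (lba B' (idt L' (fob F x)) (F2 y z))
      = cmp L' (cmp L' (F2 (lbo B x y) z + F2 y (lbo B x z))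
                       (lba B' (F2 x y) (idt L' (fob F z)) + lba B' (idt L' (fob F y)) (F2 x z)))
               (jctr B' (fob F x) (fob F y) (fob F z))"
    by (simp add: fob_eq far_eq F2_eq dom.B_eq cod.B_eq cod.cmp_eq f_push
        dom.EL_dif_elim cod.EL_dif_elim algebra_simps)
qed

end

lemma (in lie2_morphism) F2_src_tgt [simp]:
  "x \<in> carr (Ob L) \<Longrightarrow> y \<in> carr (Ob L) \<Longrightarrow> src L' (F2 x y) = lbo B' (fob F x) (fob F y)"
  "x \<in> carr (Ob L) \<Longrightarrow> y \<in> carr (Ob L) \<Longrightarrow> tgt L' (F2 x y) = fob F (lbo B x y)"
  using F2_arrow by (simp_all add: arrow_in_def)

text \<open>The second component is minus the kernel part of \<open>F2\<close>. Naturality of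
  \<open>F2\<close> with an identity in one slot gives the mixed-degree axioms. Uniqueness needs
  this direction, as it starts from given morphisms of Lie 2-algebras.\<close>

lemma (in lie2_morphism) el_morphism_of_lie2:
  "el_morphism (nerve L) (el_of_lie2 L B) (nerve L') (el_of_lie2 L' B') (cmap_of_ftor F)
     (\<lambda>x y. idt L' (lbo B' (fob F x) (fob F y)) - F2 x y)"
proof -
  note [simp] = linear_map_simps[OF linear_functorD(1)[OF F_functor] dom.Ob_vspace]
    linear_map_simps[OF linear_functorD(2)[OF F_functor] dom.Ar_vspace] linear_functorD(3-5)[OF F_functor]
    bilinear_map_simps[OF F2_bilinear dom.Ob_vspace dom.Ob_vspace]
  show ?thesis
  proof (intro el_morphism.intro dom.el_of_lie2 cod.el_of_lie2 el_morphism_axioms.intro; (unfold unfold_nerve)?)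
    show "chain_map (nerve L) (nerve L') (cmap_of_ftor F)"
      by (rule ftor_cmap.nerve_chain[OF cmap_of_ftor[OF dom.linear_category_axioms
              cod.linear_category_axioms F_functor]])
  next
    fix a y assume "a \<in> carr (Ar L) \<and> src L a = 0" "y \<in> carr (Ob L)"
    then show "br10 (el_of_lie2 L' B') (m1 (cmap_of_ftor F) a) (m0 (cmap_of_ftor F) y)
        - m1 (cmap_of_ftor F) (br10 (el_of_lie2 L B) a y)
      = idt L' (lbo B' (fob F (tgt L a)) (fob F y)) - F2 (tgt L a) y"
      using F2_natural[of a "idt L y"]
      by (simp add: el_of_lie2_def cmap_of_ftor_def cod.cmp_eq algebra_simps)
  next
    fix x b assume "x \<in> carr (Ob L)" "b \<in> carr (Ar L) \<and> src L b = 0"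
    then show "br01 (el_of_lie2 L' B') (m0 (cmap_of_ftor F) x) (m1 (cmap_of_ftor F) b)
        - m1 (cmap_of_ftor F) (br01 (el_of_lie2 L B) x b)
      = idt L' (lbo B' (fob F x) (fob F (tgt L b))) - F2 x (tgt L b)"
      using F2_natural[of "idt L x" b]
      by (simp add: el_of_lie2_def cmap_of_ftor_def cod.cmp_eq algebra_simps)
  next
    fix x y assume [simp]: "x \<in> carr (Ob L)" "y \<in> carr (Ob L)"
    show "alt (el_of_lie2 L' B') (m0 (cmap_of_ftor F) x) (m0 (cmap_of_ftor F) y)
        - m1 (cmap_of_ftor F) (alt (el_of_lie2 L B) x y)
      = idt L' (lbo B' (fob F x) (fob F y)) - F2 x y + (idt L' (lbo B' (fob F y) (fob F x)) - F2 y x)"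
      using F2_S[of x y]
      by (simp add: el_of_lie2_def cmap_of_ftor_def cod.cmp_eq algebra_simps)
    fix z assume [simp]: "z \<in> carr (Ob L)"
    show "jac (el_of_lie2 L' B') (m0 (cmap_of_ftor F) x) (m0 (cmap_of_ftor F) y) (m0 (cmap_of_ftor F) z)
        - m1 (cmap_of_ftor F) (jac (el_of_lie2 L B) x y z)
      = br01 (el_of_lie2 L' B') (m0 (cmap_of_ftor F) x) (idt L' (lbo B' (fob F y) (fob F z)) - F2 y z)
        - br01 (el_of_lie2 L' B') (m0 (cmap_of_ftor F) y) (idt L' (lbo B' (fob F x) (fob F z)) - F2 x z)
        - br10 (el_of_lie2 L' B') (idt L' (lbo B' (fob F x) (fob F y)) - F2 x y) (m0 (cmap_of_ftor F) z)
        - (idt L' (lbo B' (fob F (br00 (el_of_lie2 L B) x y)) (fob F z)) - F2 (br00 (el_of_lie2 L B) x y) z)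
        - (idt L' (lbo B' (fob F y) (fob F (br00 (el_of_lie2 L B) x z))) - F2 y (br00 (el_of_lie2 L B) x z))
        + (idt L' (lbo B' (fob F x) (fob F (br00 (el_of_lie2 L B) y z))) - F2 x (br00 (el_of_lie2 L B) y z))"
      using F2_J[of x y z]
      by (simp add: el_of_lie2_def cmap_of_ftor_def cod.cmp_eq algebra_simps)
  qed (simp_all add: el_of_lie2_def cmap_of_ftor_def bilinear_map_def linear_map_def unfold_nerve
        algebra_simps)
qed

section \<open>2-morphisms and equivalences\<close>

text \<open>The arrow with source f x and kernel part - \<theta> x has target f x - d \<theta> x = g
  x. The bracket of two such arrows accounts for the quadratic term in the equation of a
  2-morphism.\<close>

lemma lie2_2morphism_of_el:
  assumes "lie2_el_morphism L B E L' B' E' F f f2 F2" and "lie2_el_morphism L B E L' B' E' G g g2 G2"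
    and \<theta>: "el_2morphism (nerve L) E (nerve L') E' f f2 g g2 \<theta>"
  shows "lie2_2morphism L B L' B' F F2 G G2 (\<lambda>x. idt L' (m0 f x) - \<theta> x)"
proof -
  interpret F: lie2_el_morphism L B E L' B' E' F f f2 F2 by fact
  interpret G: lie2_el_morphism L B E L' B' E' G g g2 G2 by fact
  note \<theta> = \<theta>[unfolded el_2morphism_def br11_def unfold_nerve]
  have lin: "linear_map (C0 (nerve L)) (C1 (nerve L')) \<theta>"
    using \<theta> by (simp add: unfold_nerve)
  note [simp] = linear_map_simps[OF lin F.dom.el.C0_vspace, unfolded unfold_nerve]
  have g0 [simp]: "m0 g x = m0 f x - tgt L' (\<theta> x)" if "x \<in> carr (Ob L)" for x
    using \<theta> that by (simp add: algebra_simps)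
  have g1: "m1 g a = m1 f a - \<theta> (tgt L a)" if "a \<in> carr (Ar L)" "src L a = 0" for a
    using \<theta> that by (simp add: algebra_simps)
  have g2: "g2 x y = f2 x y - br01 E' (m0 f x) (\<theta> y) - br10 E' (\<theta> x) (m0 f y) + \<theta> (br00 E x y)
      + br01 E' (tgt L' (\<theta> x)) (\<theta> y)" if "x \<in> carr (Ob L)" "y \<in> carr (Ob L)" for x y
    using \<theta> that by (simp add: algebra_simps)
  show ?thesis
    unfolding lie2_2morphism_def linear_nat_trans_def
  proof (intro conjI ballI)
    show "linear_map (Ob L) (Ar L') (\<lambda>x. idt L' (m0 f x) - \<theta> x)"
      by (simp add: linear_map_def algebra_simps)
  next
    fix x y assume [simp]: "x \<in> carr (Ob L)" "y \<in> carr (Ob L)"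
    show "arrow_in L' (idt L' (m0 f x) - \<theta> x) (fob F x) (fob G x)"
      by (simp add: arrow_in_def F.fob_eq G.fob_eq)
    show "cmp L' (idt L' (m0 f (lbo B x y)) - \<theta> (lbo B x y)) (F2 x y)
        = cmp L' (G2 x y) (lba B' (idt L' (m0 f x) - \<theta> x) (idt L' (m0 f y) - \<theta> y))"
      by (simp add: F.F2_eq G.F2_eq g2 F.dom.B_eq F.cod.B_eq F.cod.cmp_eq F.f_push algebra_simps)
  next
    fix u assume [simp]: "u \<in> carr (Ar L)"
    show "cmp L' (idt L' (m0 f (tgt L u)) - \<theta> (tgt L u)) (far F u)
        = cmp L' (far G u) (idt L' (m0 f (src L u)) - \<theta> (src L u))"
      by (simp add: F.far_eq G.far_eq g1 F.cod.cmp_eq algebra_simps)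
  qed
qed

lemma lie2_isomorphic_1morphisms_of_el:
  assumes F: "lie2_el_morphism L B E L' B' E' F f f2 F2" and G: "lie2_el_morphism L B E L' B' E' G g g2 G2"
    and iso: "el_isomorphic_1morphisms (nerve L) E (nerve L') E' f f2 g g2"
  shows "lie2_isomorphic_1morphisms L B L' B' F F2 G G2"
proof -
  interpret F: lie2_el_morphism L B E L' B' E' F f f2 F2 by fact
  interpret G: lie2_el_morphism L B E L' B' E' G g g2 G2 by fact
  obtain \<theta> \<phi> where \<theta>: "el_2morphism (nerve L) E (nerve L') E' f f2 g g2 \<theta>"
    and \<phi>: "el_2morphism (nerve L) E (nerve L') E' g g2 f f2 \<phi>"
    and inv: "\<And>x. x \<in> carr (Ob L) \<Longrightarrow> \<theta> x + \<phi> x = 0"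
    using iso by (auto simp: el_isomorphic_1morphisms_def unfold_nerve)
  have "cmp L' (idt L' (m0 g x) - \<phi> x) (idt L' (m0 f x) - \<theta> x) = idt L' (fob F x) \<and>
    cmp L' (idt L' (m0 f x) - \<theta> x) (idt L' (m0 g x) - \<phi> x) = idt L' (fob G x)"
    if [simp]: "x \<in> carr (Ob L)" for x
  proof -
    have [simp]: "\<theta> x \<in> carr (Ar L')" "src L' (\<theta> x) = 0" "m0 f x - m0 g x = tgt L' (\<theta> x)"
      using \<theta> by (simp_all add: el_2morphism_def linear_map_def unfold_nerve)
    have [simp]: "\<phi> x = - \<theta> x" "m0 g x = m0 f x - tgt L' (\<theta> x)"
      using inv[of x] by (simp_all add: eq_neg_iff_add_eq_0 add.commute algebra_simps flip: \<open>m0 f x - m0 g x = _\<close>)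
    show ?thesis
      by (simp add: F.fob_eq G.fob_eq F.cod.cmp_eq)
  qed
  then show ?thesis
    using lie2_2morphism_of_el[OF F G \<theta>] lie2_2morphism_of_el[OF G F \<phi>]
    unfolding lie2_isomorphic_1morphisms_def by blast
qed

text \<open>Composing arrows adds their kernel parts, which turns the composite of second components
  into the sum in \<open>el_comp2\<close>. The dictionary thus respects composition strictly, and
  equivalence data can be carried over.\<close>

lemma lie2_el_morphism_comp:
  assumes "lie2_el_morphism L B E L' B' E' F f f2 F2"
    and "lie2_el_morphism L' B' E' L'' B'' E'' G g g2 G2"
  shows "lie2_el_morphism L B E L'' B'' E'' (comp_ftor G F) (comp_cmap g f) (el_comp2 g g2 f f2)
    (lie2_comp2 L'' G G2 F F2)"
proof -
  interpret F: lie2_el_morphism L B E L' B' E' F f f2 F2 by fact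
  interpret G: lie2_el_morphism L' B' E' L'' B'' E'' G g g2 G2 by fact
  interpret GF: el_morphism "nerve L" E "nerve L''" E'' "comp_cmap g f" "el_comp2 g g2 f f2"
    by (rule el_morphism_comp[OF F.el.el_morphism_axioms G.el.el_morphism_axioms])
  show ?thesis
  proof (intro lie2_el_morphism.intro lie2_el_morphism_axioms.intro ftor_cmap.intro
      ftor_cmap_axioms.intro GF.chain GF.el_morphism_axioms F.dom.lie2_el_axioms G.cod.lie2_el_axioms
      F.dom.linear_category_axioms G.cod.linear_category_axioms)
    show "x \<in> carr (Ob L) \<Longrightarrow> fob (comp_ftor G F) x = m0 (comp_cmap g f) x" for x
      by (simp add: comp_ftor_def comp_cmap_def F.fob_eq G.fob_eq)
    show "u \<in> carr (Ar L) \<Longrightarrow> far (comp_ftor G F) u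
        = idt L'' (m0 (comp_cmap g f) (src L u)) + m1 (comp_cmap g f) (ker_part L u)" for u
      by (simp add: comp_ftor_def comp_cmap_def F.far_eq G.far_eq)
    show "x \<in> carr (Ob L) \<Longrightarrow> y \<in> carr (Ob L) \<Longrightarrow> lie2_comp2 L'' G G2 F F2 x y
        = idt L'' (br00 E'' (m0 (comp_cmap g f) x) (m0 (comp_cmap g f) y)) - el_comp2 g g2 f f2 x y" for x y
      by (simp add: comp_cmap_def lie2_comp2_def el_comp2_def F.fob_eq F.F2_eq G.F2_eq G.far_eq
          G.cod.cmp_eq G.f_push algebra_simps)
  qed
qed

lemma (in lie2_el) lie2_el_morphism_id:
  "lie2_el_morphism L B E L B E id_ftor id_cmap el_id2 (lie2_id2 L B)"
proof -
  interpret id: el_morphism "nerve L" E "nerve L" E id_cmap el_id2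
    by (rule el.el_morphism_id)
  show ?thesis
    by (intro lie2_el_morphism.intro lie2_el_morphism_axioms.intro ftor_cmap.intro
      ftor_cmap_axioms.intro id.chain id.el_morphism_axioms lie2_el_axioms linear_category_axioms)
      (simp_all add: id_ftor_def id_cmap_def el_id2_def lie2_id2_def lbo_eq ker_part_def)
qed

lemma lie2_equivalence_of_el:
  assumes F: "lie2_el_morphism L B E L' B' E' F f f2 F2"
    and equiv: "el_equivalence (nerve L) E (nerve L') E' f f2"
  shows "lie2_equivalence L B L' B' F F2"
proof -
  interpret F: lie2_el_morphism L B E L' B' E' F f f2 F2 by fact
  obtain g g2 where g: "el_morphism (nerve L') E' (nerve L) E g g2"
    and iso: "el_isomorphic_1morphisms (nerve L) E (nerve L) E
          (comp_cmap g f) (el_comp2 g g2 f f2) id_cmap el_id2"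
      "el_isomorphic_1morphisms (nerve L') E' (nerve L') E'
          (comp_cmap f g) (el_comp2 f f2 g g2) id_cmap el_id2"
    using equiv by (auto simp: el_equivalence_def)
  \<comment> \<open>F is prescribed, but its inverse is free: it is rebuilt from the inverse g on
    normalized complexes.\<close>
  define G where "G = ftor_of_cmap L' L g"
  define G2 where "G2 x y = idt L (br00 E (m0 g x) (m0 g y)) - g2 x y" for x y
  have G: "lie2_el_morphism L' B' E' L B E G g g2 G2"
    unfolding G_def
    by (intro lie2_el_morphism.intro lie2_el_morphism_axioms.intro g ftor_of_cmap
        el_morphism.chain[OF g] F.dom.lie2_el_axioms F.cod.lie2_el_axioms
        F.dom.linear_category_axioms F.cod.linear_category_axioms G2_def)
  show ?thesis
    unfolding lie2_equivalence_def
    using F.lie2_morphism lie2_el_morphism.lie2_morphism[OF G]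
      lie2_isomorphic_1morphisms_of_el[OF lie2_el_morphism_comp[OF F G] F.dom.lie2_el_morphism_id iso(1)]
      lie2_isomorphic_1morphisms_of_el[OF lie2_el_morphism_comp[OF G F] F.cod.lie2_el_morphism_id iso(2)]
    by blast
qed

section \<open>Transfer along equivalences of linear categories\<close>

lemma lie2_equivalent_of_el:
  assumes "lie2_el L B E" and "lie2_el L' B' E'" and equiv: "el_equivalence (nerve L) E (nerve L') E' f f2"
  shows "lie2_equivalent L B L' B'"
proof -
  interpret dom: lie2_el L B E by fact
  interpret cod: lie2_el L' B' E' by fact
  have f: "el_morphism (nerve L) E (nerve L') E' f f2"
    using equiv by (simp add: el_equivalence_def)
  have "lie2_el_morphism L B E L' B' E' (ftor_of_cmap L L' f) f f2
      (\<lambda>x y. idt L' (br00 E' (m0 f x) (m0 f y)) - f2 x y)"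
    by (intro lie2_el_morphism.intro lie2_el_morphism_axioms.intro ftor_of_cmap f refl
        el_morphism.chain[OF f] assms dom.linear_category_axioms cod.linear_category_axioms)
  then show ?thesis
    unfolding lie2_equivalent_def using lie2_equivalence_of_el[OF _ equiv] by blast
qed

text \<open>Arrows from 0 to x are the kernel elements with differential x. Bijectivity of F on them
  gives \<open>inj\<close> (at x = 0) and \<open>lift\<close>. The kernel part of an isomorphism
  from F x to y, negated, has differential F x - y, which gives \<open>surj\<close>.\<close>

lemma ff_es_chain_equiv:
  assumes "linear_category L" and "linear_category L'" and F: "linear_functor L L' F"
    and ff: "fully_faithful L L' F" and es: "essentially_surjective L L' F"
  obtains g h k where "chain_equiv (nerve L) (nerve L') (cmap_of_ftor F) g h k"
proof -
  interpret dom: linear_category L by fact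
  interpret cod: linear_category L' by fact
  interpret ftor_cmap L L' F "cmap_of_ftor F"
    by (rule cmap_of_ftor[OF assms(1,2) F])
  have F_eq: "m0 (cmap_of_ftor F) = fob F" "m1 (cmap_of_ftor F) = far F"
    by (simp_all add: cmap_of_ftor_def)
  note [simp] = f_simps[unfolded F_eq]
  have bij: "bij_betw (far F) {u. arrow_in L u 0 x} {v. arrow_in L' v 0 (fob F x)}"
    if "x \<in> carr (Ob L)" for x
    using ff[unfolded fully_faithful_def, rule_format, of 0 x] that by simp
  show thesis
  proof (rule chain_equivI[OF dom.nerve_complex cod.nerve_complex nerve_chain _ _ _ that];
      (unfold unfold_nerve F_eq)?)
    fix a assume a: "a \<in> carr (Ar L) \<and> src L a = 0" "tgt L a = 0" "far F a = 0"
    have "a = 0"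
      by (rule inj_onD[OF bij_betw_imp_inj_on[OF bij[of 0]]]) (use a in \<open>simp_all add: arrow_in_def\<close>)
    then show "a = 0" .
  next
    fix x b assume x: "x \<in> carr (Ob L)" and b: "b \<in> carr (Ar L') \<and> src L' b = 0" "fob F x = tgt L' b"
    then have "b \<in> far F ` {u. arrow_in L u 0 x}"
      using bij_betw_imp_surj_on[OF bij[OF x]] by (simp add: arrow_in_def)
    then show "\<exists>a\<in>{a. a \<in> carr (Ar L) \<and> src L a = 0}. tgt L a = x \<and> far F a = b"
      by (auto simp: arrow_in_def)
  next
    fix y assume "y \<in> carr (Ob L')"
    then obtain x u where x: "x \<in> carr (Ob L)" and u: "arrow_in L' u (fob F x) y"
      using es by (auto simp: essentially_surjective_def isomorphic_objects_def)
    show "\<exists>x\<in>carr (Ob L). \<exists>b\<in>{a. a \<in> carr (Ar L') \<and> src L' a = 0}. fob F x = y + tgt L' b"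
      by (rule bexI[OF _ x], rule bexI[of _ "- ker_part L' u"]) (use u in \<open>simp_all add: arrow_in_def\<close>)
  qed
qed

text \<open>The transfer takes place on normalized complexes. Since \<open>ftor_cmap\<close> relates
  the chain map to the given F itself, the resulting equivalence is carried by F and not only by a
  functor rebuilt from the chain map.\<close>

lemma lie2_transfer:
  assumes L: "lie_2_algebra L B" and L': "linear_category L'" and F: "linear_functor L L' F"
    and ff: "fully_faithful L L' F" and es: "essentially_surjective L L' F"
  obtains B' F2 where "lie_2_algebra L' B'" "lie2_equivalence L B L' B' F F2"
proof -
  interpret L: lie_2_algebra L B by fact
  let ?f = "cmap_of_ftor F" and ?E = "el_of_lie2 L B"
  obtain g h k where "chain_equiv (nerve L) (nerve L') ?f g h k"
    by (rule ff_es_chain_equiv[OF L.linear_category_axioms L' F ff es])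
  then interpret tr: el_transfer "nerve L" ?E "nerve L'" ?f g h k
    by (intro el_transfer.intro L.el_of_lie2)
  interpret eq: el_chain_equiv "nerve L" ?E "nerve L'" tr.transported ?f tr.transported_f2 g h k
    by (intro el_chain_equiv.intro tr.el_morphism_transported tr.chain_equiv_axioms)
  let ?B' = "lie2_of_el L' tr.transported"
  have B': "lie2_el L' ?B' tr.transported"
    by (rule lie2_of_el[OF L' tr.el_algebra_transported])
  have "lie2_el_morphism L B ?E L' ?B' tr.transported F ?f tr.transported_f2
      (\<lambda>x y. idt L' (br00 tr.transported (m0 ?f x) (m0 ?f y)) - tr.transported_f2 x y)"
    by (intro lie2_el_morphism.intro lie2_el_morphism_axioms.intro tr.el_morphism_transported refl B'
        L.lie2_el_of_lie2 cmap_of_ftor L' L.linear_category_axioms F)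
  then show thesis
    using that lie2_el.lie_2_algebra[OF B'] lie2_equivalence_of_el eq.equivalence by blast
qed

lemma lie2_transfer_unique:
  assumes F: "linear_functor L L' F" "fully_faithful L L' F" "essentially_surjective L L' F"
    and "lie2_morphism L B L' B\<^sub>1 F F2" and "lie2_morphism L B L' B\<^sub>2 F F2'"
  shows "lie2_equivalent L' B\<^sub>1 L' B\<^sub>2"
proof -
  interpret F1: lie2_morphism L B L' B\<^sub>1 F F2 by fact
  interpret F2: lie2_morphism L B L' B\<^sub>2 F F2' by fact
  obtain g h k where fgh: "chain_equiv (nerve L) (nerve L') (cmap_of_ftor F) g h k"
    by (rule ff_es_chain_equiv[OF F1.dom.linear_category_axioms F1.cod.linear_category_axioms F])
  obtain p p2 h where
    "el_chain_equiv (nerve L') (el_of_lie2 L' B\<^sub>1) (nerve L') (el_of_lie2 L' B\<^sub>2) p p2 id_cmap h h"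
    by (rule el_equivalent_if_common_source[OF fgh F1.el_morphism_of_lie2 F2.el_morphism_of_lie2])
  then show ?thesis
    by (rule lie2_equivalent_of_el[OF F1.cod.lie2_el_of_lie2 F2.cod.lie2_el_of_lie2
          el_chain_equiv.equivalence])
qed

section \<open>Skeletal models\<close>

definition full_subcategory :: "('k, 'o, 'a) lincat \<Rightarrow> 'o set \<Rightarrow> ('k, 'o, 'a) lincat" where
  "full_subcategory L X = L\<lparr>Ob := (Ob L)\<lparr>carr := X\<rparr>,
     Ar := (Ar L)\<lparr>carr := {u \<in> carr (Ar L). src L u \<in> X \<and> tgt L u \<in> X}\<rparr>\<rparr>"

context linear_category
begin

lemma full_subcategory:
  assumes X: "module.subspace (smul (Ob L)) X" "X \<subseteq> carr (Ob L)"
  shows "linear_category (full_subcategory L X)"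
    and "linear_functor (full_subcategory L X) L id_ftor"
    and "fully_faithful (full_subcategory L X) L id_ftor"
proof -
  interpret Ob: vector_space "smul (Ob L)"
    using Ob_vspace by (simp add: is_vspace_def)
  interpret Ar: vector_space "smul (Ar L)"
    using Ar_vspace by (simp add: is_vspace_def)
  have [simp]: "x \<in> carr (Ob L)" if "x \<in> X" for x
    using X(2) that by auto
  note [simp] = Ob.subspace_add[OF X(1)] Ob.subspace_scale[OF X(1)] Ob.subspace_0[OF X(1)]
  let ?A = "{u \<in> carr (Ar L). src L u \<in> X \<and> tgt L u \<in> X}"
  have A: "Ar.subspace ?A"
    by (rule Ar.subspaceI) simp_all
  show "linear_category (full_subcategory L X)"
  proof
    fix h g f assume "composable (full_subcategory L X) h g" "composable (full_subcategory L X) g f"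
    then show "cmp (full_subcategory L X) h (cmp (full_subcategory L X) g f)
        = cmp (full_subcategory L X) (cmp (full_subcategory L X) h g) f"
      using cmp_assoc[of h g f] by (simp add: composable_def full_subcategory_def)
  qed (use X A in \<open>simp_all add: full_subcategory_def is_vspace_def Ob.vector_space_axioms
        Ar.vector_space_axioms linear_map_def composable_def arrow_in_def cmp_eq algebra_simps\<close>)
  show "linear_functor (full_subcategory L X) L id_ftor"
    by (simp add: linear_functor_def linear_map_def id_ftor_def full_subcategory_def)
  show "fully_faithful (full_subcategory L X) L id_ftor"
    by (auto simp: fully_faithful_def id_ftor_def full_subcategory_def arrow_in_def bij_betw_def inj_on_def)
qed

text \<open>Two objects are isomorphic exactly when they differ by a boundary. The kernel
  \<open>X\<close> of a retraction onto the boundaries therefore meets every isomorphism class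
  exactly once.\<close>

lemma skeleton_exists:
  obtains X where "linear_category (full_subcategory L X)"
    and "linear_functor (full_subcategory L X) L id_ftor"
    and "fully_faithful (full_subcategory L X) L id_ftor"
    and "essentially_surjective (full_subcategory L X) L id_ftor"
    and "skeletal (full_subcategory L X)"
proof -
  interpret Ob: vector_space "smul (Ob L)"
    using Ob_vspace by (simp add: is_vspace_def)
  let ?S = "tgt L ` {a \<in> carr (Ar L). src L a = 0}"
  have S: "Ob.subspace ?S"
  proof (rule Ob.subspaceI)
    show "0 \<in> ?S" by (rule image_eqI[of _ _ 0]) simp_all
    show "x + y \<in> ?S" if "x \<in> ?S" "y \<in> ?S" for x y
    proof -
      obtain a b where "x = tgt L a" "y = tgt L b" "a \<in> carr (Ar L)" "src L a = 0"
        "b \<in> carr (Ar L)" "src L b = 0"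
        using \<open>x \<in> ?S\<close> \<open>y \<in> ?S\<close> by auto
      then show ?thesis by (intro image_eqI[of _ _ "a + b"]) simp_all
    qed
    show "smul (Ob L) c x \<in> ?S" if "x \<in> ?S" for c x
    proof -
      obtain a where "x = tgt L a" "a \<in> carr (Ar L)" "src L a = 0"
        using \<open>x \<in> ?S\<close> by auto
      then show ?thesis by (intro image_eqI[of _ _ "smul (Ar L) c a"]) simp_all
    qed
  qed
  have S_carr: "?S \<subseteq> carr (Ob L)" by auto
  obtain p where p: "linear_map (Ob L) (Ob L) p"
    and p_in: "\<And>x. x \<in> carr (Ob L) \<Longrightarrow> p x \<in> ?S" and p_id: "\<And>x. x \<in> ?S \<Longrightarrow> p x = x"
    by (rule linear_retraction[OF Ob_vspace S S_carr]) blast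
  note [simp] = linear_map_simps[OF p Ob_vspace]
  define X where "X = {x \<in> carr (Ob L). p x = 0}"
  have X: "Ob.subspace X" "X \<subseteq> carr (Ob L)"
    by (auto simp: X_def intro!: Ob.subspaceI)
  show thesis
  proof (rule that[OF full_subcategory[OF X]])
    show "essentially_surjective (full_subcategory L X) L id_ftor"
      unfolding essentially_surjective_def
    proof (intro ballI bexI)
      fix y assume y: "y \<in> carr (Ob L)"
      then obtain a where a: "a \<in> carr (Ar L)" "src L a = 0" "p y = tgt L a"
        using p_in[OF y] by auto
      have "p (p y) = p y" using p_in[OF y] by (rule p_id)
      then show "y - p y \<in> carr (Ob (full_subcategory L X))"
        using y by (simp add: full_subcategory_def X_def)
      \<comment> \<open>The boundary p y = d a is removed from y; shifting a by the identity of y -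
        p y gives the connecting arrow, invertible like every arrow.\<close>
      have "arrow_in L (idt L (y - p y) + a) (y - p y) y"
        using y a by (simp add: arrow_in_def)
      then show "isomorphic_objects L (fob id_ftor (y - p y)) y"
        by (auto simp: isomorphic_objects_def inverse_arrows_iff id_ftor_def arrow_in_def)
    qed
    show "skeletal (full_subcategory L X)"
      unfolding skeletal_def
    proof (intro ballI impI)
      fix x y
      assume xy: "x \<in> carr (Ob (full_subcategory L X))" "y \<in> carr (Ob (full_subcategory L X))"
        and "isomorphic_objects (full_subcategory L X) x y"
      then obtain u where "u \<in> carr (Ar L)" "src L u = x" "tgt L u = y"
        by (auto simp: isomorphic_objects_def arrow_in_def full_subcategory_def)
      then have "y - x \<in> ?S"
        by (intro image_eqI[of _ _ "ker_part L u"]) simp_all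
      then have "p (y - x) = y - x" by (rule p_id)
      with xy show "x = y"
        by (simp add: full_subcategory_def X_def)
    qed
  qed
qed

end

text \<open>The structure to be transferred lives on L, whereas the inclusion points from the
  skeleton to L. The homotopy equivalence is therefore reversed by \<open>chain_equiv_sym\<close>,
  and the transfer runs along the homotopy inverse g of the inclusion.\<close>

lemma lie2_skeletal_model:
  fixes L :: "('k::field, 'o::ab_group_add, 'a::ab_group_add) lincat"
  assumes "lie_2_algebra L B"
  shows "\<exists>(K :: ('k, 'o, 'a) lincat) B\<^sub>K. lie_2_algebra K B\<^sub>K \<and> skeletal K \<and> lie2_equivalent L B K B\<^sub>K"
proof -
  interpret L: lie_2_algebra L B by fact
  let ?E = "el_of_lie2 L B"
  obtain X where X: "linear_category (full_subcategory L X)"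
    "linear_functor (full_subcategory L X) L id_ftor"
    "fully_faithful (full_subcategory L X) L id_ftor"
    "essentially_surjective (full_subcategory L X) L id_ftor"
    and skel: "skeletal (full_subcategory L X)"
    by (rule L.skeleton_exists)
  let ?K = "full_subcategory L X"
  obtain g h k where incl: "chain_equiv (nerve ?K) (nerve L) (cmap_of_ftor id_ftor) g h k"
    by (rule ff_es_chain_equiv[OF X(1) L.linear_category_axioms X(2-4)])
  interpret tr: el_transfer "nerve L" ?E "nerve ?K" g "cmap_of_ftor id_ftor" k h
    by (intro el_transfer.intro L.el_of_lie2 chain_equiv.chain_equiv_sym[OF incl])
  interpret eq: el_chain_equiv "nerve L" ?E "nerve ?K" tr.transported g tr.transported_f2 "cmap_of_ftor id_ftor" k h
    by (intro el_chain_equiv.intro tr.el_morphism_transported tr.chain_equiv_axioms)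
  have K: "lie2_el ?K (lie2_of_el ?K tr.transported) tr.transported"
    by (rule lie2_of_el[OF X(1) tr.el_algebra_transported])
  show ?thesis
    using lie2_el.lie_2_algebra[OF K] skel
      lie2_equivalent_of_el[OF L.lie2_el_of_lie2 K eq.equivalence] by blast
qed

theorem theorem4p1:
  fixes C :: "('k::field, 'o::ab_group_add, 'a::ab_group_add) cplx2"
    and E :: "('o, 'a) el_struct"
    and C' :: "('k, 'p::ab_group_add, 'b::ab_group_add) cplx2"
    and f :: "('o, 'a, 'p, 'b) cmap"
    and L :: "('k, 'o, 'a) lincat"
    and B :: "('o, 'a) lie2_struct"
    and L' :: "('k, 'p, 'b) lincat"
    and F :: "('o, 'a, 'p, 'b) ftor"
  shows
    "(el_algebra C E \<and> two_term_complex C' \<and> quasi_iso C C' f \<longrightarrow>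
        (\<exists>E' f2. el_algebra C' E' \<and> el_morphism C E C' E' f f2 \<and>
                 el_equivalence C E C' E' f f2) \<and>
        (\<forall>E\<^sub>1 E\<^sub>2.
           el_algebra C' E\<^sub>1 \<and> (\<exists>f2. el_morphism C E C' E\<^sub>1 f f2 \<and> el_equivalence C E C' E\<^sub>1 f f2) \<and>
           el_algebra C' E\<^sub>2 \<and> (\<exists>f2. el_morphism C E C' E\<^sub>2 f f2 \<and> el_equivalence C E C' E\<^sub>2 f f2) \<longrightarrow>
           el_equivalent C' E\<^sub>1 C' E\<^sub>2))
     \<and>
     (lie_2_algebra L B \<and> linear_category L' \<and> linear_functor L L' F \<and>
      fully_faithful L L' F \<and> essentially_surjective L L' F \<longrightarrow>
        (\<exists>B' F2. lie_2_algebra L' B' \<and> lie2_morphism L B L' B' F F2 \<and>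
                 lie2_equivalence L B L' B' F F2) \<and>
        (\<forall>B\<^sub>1 B\<^sub>2.
           lie_2_algebra L' B\<^sub>1 \<and> (\<exists>F2. lie2_morphism L B L' B\<^sub>1 F F2 \<and> lie2_equivalence L B L' B\<^sub>1 F F2) \<and>
           lie_2_algebra L' B\<^sub>2 \<and> (\<exists>F2. lie2_morphism L B L' B\<^sub>2 F F2 \<and> lie2_equivalence L B L' B\<^sub>2 F F2) \<longrightarrow>
           lie2_equivalent L' B\<^sub>1 L' B\<^sub>2))
     \<and>
     (lie_2_algebra L B \<longrightarrow>
        (\<exists>(K :: ('k, 'o, 'a) lincat) B\<^sub>K.
           lie_2_algebra K B\<^sub>K \<and> skeletal K \<and> lie2_equivalent L B K B\<^sub>K))"
proof (intro conjI impI allI; (elim conjE exE)?)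
  assume "el_algebra C E" "two_term_complex C'" "quasi_iso C C' f"
  then show "\<exists>E' f2. el_algebra C' E' \<and> el_morphism C E C' E' f f2 \<and> el_equivalence C E C' E' f f2"
    using el_transfer_exists[of C E C' f] by (auto simp: el_equivalence_def)
next
  fix E\<^sub>1 E\<^sub>2 f2 f2'
  assume "quasi_iso C C' f" "el_morphism C E C' E\<^sub>1 f f2" "el_morphism C E C' E\<^sub>2 f f2'"
  then show "el_equivalent C' E\<^sub>1 C' E\<^sub>2"
    by (rule el_transfer_unique)
next
  assume "lie_2_algebra L B" "linear_category L'" "linear_functor L L' F"
    "fully_faithful L L' F" "essentially_surjective L L' F"
  then show "\<exists>B' F2. lie_2_algebra L' B' \<and> lie2_morphism L B L' B' F F2 \<and> lie2_equivalence L B L' B' F F2"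
    by (rule lie2_transfer) (auto simp: lie2_equivalence_def)
next
  fix B\<^sub>1 B\<^sub>2 F2 F2'
  assume "linear_functor L L' F" "fully_faithful L L' F" "essentially_surjective L L' F"
    "lie2_morphism L B L' B\<^sub>1 F F2" "lie2_morphism L B L' B\<^sub>2 F F2'"
  then show "lie2_equivalent L' B\<^sub>1 L' B\<^sub>2"
    by (rule lie2_transfer_unique)
next
  assume "lie_2_algebra L B"
  then show "\<exists>(K :: ('k, 'o, 'a) lincat) B\<^sub>K. lie_2_algebra K B\<^sub>K \<and> skeletal K \<and> lie2_equivalent L B K B\<^sub>K"
    by (rule lie2_skeletal_model)
qed

end
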